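(* Let $X,Y$ be Banach spaces over $\mathbb{K}$ and let $\mathcal{Z}$ be a linear subspace of $\ell_\infty(B_X)$. Assume $\Phi\in\ell_\infty(B_X,Y)$ with $\|\Phi\|=1$. Then the following are equivalent: (1) For every $x'\in\mathcal{Z}$ and every $y\in Y$, $\max_{|\omega|=1}\|\Phi+\omega\, x'\otimes y\|=\|\Phi\|+\|x'\otimes y\|$. (2) For every $x'\in S_{\mathcal{Z}}$, every $y\in S_Y$, and every $\varepsilon>0$, there exist $\omega_1,\omega_2\in\mathbb{T}$ and $x\in B_X$ such that $$\operatorname{Re}\omega_1x'(x)\ge1-\varepsilon\quad\text{and}\quad\|\omega_2\Phi(x)+y\|\ge2-\varepsilon.$$ (3) For every $x'\in S_{\mathcal{Z}}$, every $y\in S_Y$, and every $\varepsilon>0$, there exist $\omega\in\mathbb{T}$ and $x\in B_X$ such that $$|x'(x)|\ge1-\varepsilon\quad\text{and}\quad\|\omega\Phi(x)+y\|\ge2-\varepsilon.$$ (4) Every weakly compact $\Psi\in\ell_\infty(B_X,Y)$ such that $y^*\circ\Psi\in\mathcal{Z}$ for all $y^*\in Y^*$ satisfies $\max_{|\omega|=1}\|\Phi+\omega\Psi\|=\|\Phi\|+\|\Psi\|$.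
   Context: $\mathbb{K}$ is $\mathbb{R}$ or $\mathbb{C}$, and $\mathbb{T}=\{\omega\in\mathbb{K}:|\omega|=1\}$; in $\max_{|\omega|=1}$ the variable $\omega$ runs over $\mathbb{T}$. $B_X$ is the closed unit ball and $S_X$ the unit sphere of a normed space $X$; $Y^*$ is the dual of $Y$. $\ell_\infty(B_X,Y)$ is the space of all bounded (not necessarily linear or continuous) maps $\Phi:B_X\to Y$ with $\|\Phi\|=\sup_{x\in B_X}\|\Phi(x)\|$; $\ell_\infty(B_X)=\ell_\infty(B_X,\mathbb{K})$, and $S_{\mathcal{Z}}$ is the unit sphere of $\mathcal{Z}$ in this norm. For $x'\in\ell_\infty(B_X)$ and $y\in Y$, $x'\otimes y$ is the map $x\mapsto x'(x)y$. $\Psi\in\ell_\infty(B_X,Y)$ is weakly compact if the weak closure of $\Psi(B_X)$ is a weakly compact set. *)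

theory Defs
  imports "HOL-Analysis.Analysis" "HOL-Library.Function_Algebras"
begin

text \<open>
  Up to isometric isomorphism the instances of the following class are exactly the fields of real
  and of complex numbers. The embedding into the complex numbers only serves to pin this down and
  to speak about real parts uniformly.
\<close>

class real_or_complex = real_normed_field +
  fixes to_complex :: "'a \<Rightarrow> complex"
  assumes to_complex_add: "to_complex (a + b) = to_complex a + to_complex b"
    and to_complex_mult: "to_complex (a * b) = to_complex a * to_complex b"
    and to_complex_scaleR: "to_complex (scaleR r a) = scaleR r (to_complex a)"
    and norm_to_complex: "norm (to_complex a) = norm a"
    and range_to_complex: "range to_complex = \<real> \<or> range to_complex = UNIV"

instantiation real :: real_or_complex
begin
definition to_complex_real :: "real \<Rightarrow> complex" where "to_complex_real = complex_of_real"
instance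
  by standard (auto simp: to_complex_real_def Reals_def scaleR_conv_of_real)
end

instantiation complex :: real_or_complex
begin
definition to_complex_complex :: "complex \<Rightarrow> complex" where "to_complex_complex = id"
instance
  by standard (auto simp: to_complex_complex_def)
end

definition re :: "'k::real_or_complex \<Rightarrow> real" where
  "re a = Re (to_complex a)"

text \<open>
  Norm and completeness of a Banach space over the scalar field come from the class
  \<^class>\<open>banach\<close>; the locale parameter is the scalar multiplication, which has to
  extend the real one.
\<close>

locale banach_space_over = vector_space smul
  for smul :: "'k::real_or_complex \<Rightarrow> 'v::banach \<Rightarrow> 'v" +
  assumes smul_of_real: "smul (of_real r) v = scaleR r v"
    and norm_smul: "norm (smul a v) = norm a * norm v"

definition dual_space :: "('k::real_or_complex \<Rightarrow> 'v::banach \<Rightarrow> 'v) \<Rightarrow> ('v \<Rightarrow> 'k) set" where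
  "dual_space smul = {f. Vector_Spaces.linear smul (*) f \<and> continuous_on UNIV f}"

definition weak_topology :: "('k::real_or_complex \<Rightarrow> 'v::banach \<Rightarrow> 'v) \<Rightarrow> 'v topology" where
  "weak_topology smul = topology_generated_by {f -` U | f U. f \<in> dual_space smul \<and> open U}"

text \<open>
  A map on the closed unit ball is represented by its extension by zero to the whole space, so
  that equality of representatives is equality of maps on the ball.
\<close>

definition ell_infty :: "('x::real_normed_vector \<Rightarrow> 'v::real_normed_vector) set" where
  "ell_infty = {\<Phi>. bounded (\<Phi> ` cball 0 1) \<and> (\<forall>x. x \<notin> cball 0 1 \<longrightarrow> \<Phi> x = 0)}"

definition sup_norm :: "('x::real_normed_vector \<Rightarrow> 'v::real_normed_vector) \<Rightarrow> real" where
  "sup_norm \<Phi> = (SUP x\<in>cball 0 1. norm (\<Phi> x))"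

definition fun_scale :: "('k \<Rightarrow> 'v \<Rightarrow> 'v) \<Rightarrow> 'k \<Rightarrow> ('x \<Rightarrow> 'v) \<Rightarrow> ('x \<Rightarrow> 'v)" where
  "fun_scale smul a \<Phi> = (\<lambda>x. smul a (\<Phi> x))"

lemma vector_space_fun_scale:
  assumes "vector_space smul"
  shows "vector_space (fun_scale smul)"
proof -
  interpret vector_space smul by fact
  show ?thesis
    by standard (auto simp: fun_scale_def fun_eq_iff scale_right_distrib scale_left_distrib)
qed

definition linear_subspace_ell_infty :: "('x::real_normed_vector \<Rightarrow> 'k::real_or_complex) set \<Rightarrow> bool" where
  "linear_subspace_ell_infty Z \<longleftrightarrow> Z \<subseteq> ell_infty \<and> module.subspace (fun_scale (*)) Z"

definition tensor :: "('k \<Rightarrow> 'v \<Rightarrow> 'v) \<Rightarrow> ('x \<Rightarrow> 'k) \<Rightarrow> 'v \<Rightarrow> ('x \<Rightarrow> 'v)" where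
  "tensor smul x' y = (\<lambda>x. smul (x' x) y)"

definition weakly_compact_map ::
    "('k::real_or_complex \<Rightarrow> 'v::banach \<Rightarrow> 'v) \<Rightarrow> ('x::real_normed_vector \<Rightarrow> 'v) \<Rightarrow> bool" where
  "weakly_compact_map smul \<Psi> \<longleftrightarrow>
     compactin (weak_topology smul) (weak_topology smul closure_of (\<Psi> ` cball 0 1))"

definition is_maximum :: "real set \<Rightarrow> real \<Rightarrow> bool" where
  "is_maximum A m \<longleftrightarrow> m \<in> A \<and> (\<forall>a\<in>A. a \<le> m)"

end

theory Submission
  imports Defs
begin

text \<open>
  The hard implication is (3) to (4). Multiplying by unimodular scalars turns \<open>\<Psi>(B\<^sub>X)\<close> into a balanced
  relatively weakly compact set. Such a set has a slice of small diameter containing a point \<open>s\<close> whose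
  norm is almost \<open>norm \<Psi>\<close>. If \<open>y\<^sup>*\<close> is the functional defining the slice, then (3), applied to the
  normalisations of \<open>y\<^sup>* \<circ> \<Psi>\<close> and \<open>s\<close>, yields a point \<open>x\<close> for which a rotation of \<open>\<Psi> x\<close> lies in the
  slice, hence is close to \<open>s\<close>, while a rotation of \<open>\<Phi> x\<close> almost adds up with \<open>s\<close> in norm.
  The small slices come from the Baire category theorem in the dual space and need neither Krein-Milman
  nor the weak compactness of closed convex hulls. Conversely, rank-one maps are weakly compact, so
  (4) implies (1), and (1) gives (3) at points where the maximum is almost attained.
\<close>

section \<open>The Hahn-Banach theorem\<close>

text \<open>Property (3) yields, at one and the same point \<open>x\<close>, only the modulus of one
  scalar function and the alignment of \<open>\<Phi> x\<close> with one vector fixed in advance.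
  That \<open>F (\<Psi> x)\<close> has almost maximal modulus says nothing by itself about
  \<open>\<Psi> x\<close>, so \<open>F\<close> has to be chosen such that large values confine
  \<open>\<Psi> x\<close>, up to rotation, to a small ball around a vector \<open>s\<close>. Norm
  closeness, not weak closeness, is what carries the estimate for \<open>\<Phi> x\<close> and
  \<open>s\<close> over to \<open>\<Phi> x\<close> and \<open>\<Psi> x\<close>. The rotations cost
  nothing because the maximum runs over all unimodular factors, and compactness of the scalar unit
  sphere reduces the equation for the maximum to approximate equality at single points. Separation
  and slicing use real functionals; scalar-linear ones enter through their real parts, when
  \<open>F \<circ> \<Psi>\<close> has to belong to \<open>Z\<close>.\<close>

definition sublinear :: "('a::real_vector \<Rightarrow> real) \<Rightarrow> bool" where
  "sublinear q \<longleftrightarrow> (\<forall>u v. q (u + v) \<le> q u + q v) \<and> (\<forall>c\<ge>0. \<forall>v. q (c *\<^sub>R v) = c * q v)"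

text \<open>The reverse inequality in homogeneity comes from the assumed one applied with
  \<open>inverse c\<close>, so one-sided estimates of infima suffice.\<close>

lemma sublinearI:
  assumes "\<And>u v. q (u + v) \<le> q u + q v" and "\<And>c v. c > 0 \<Longrightarrow> q (c *\<^sub>R v) \<le> c * q v" and "q 0 = 0"
  shows "sublinear q"
proof -
  have "q (c *\<^sub>R v) = c * q v" if "c \<ge> 0" for c v
  proof (cases "c = 0")
    case False
    with that have c: "c > 0" by simp
    have "q v \<le> inverse c * q (c *\<^sub>R v)"
      using assms(2)[of "inverse c" "c *\<^sub>R v"] c by simp
    then have "c * q v \<le> q (c *\<^sub>R v)"
      using c by (simp add: field_simps)
    with assms(2)[OF c, of v] show ?thesis by simp
  qed (simp add: assms)
  with assms(1) show ?thesis by (simp add: sublinear_def)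
qed

lemma sublinear_add: "sublinear q \<Longrightarrow> q (u + v) \<le> q u + q v"
  by (simp add: sublinear_def)

lemma sublinear_scaleR: "sublinear q \<Longrightarrow> c \<ge> 0 \<Longrightarrow> q (c *\<^sub>R v) = c * q v"
  by (simp add: sublinear_def)

lemma sublinear_zero: "sublinear q \<Longrightarrow> q 0 = 0"
  using sublinear_scaleR[of q 0 0] by simp

lemma sublinear_minus: "sublinear q \<Longrightarrow> - q (- v) \<le> q v"
  using sublinear_add[of q v "- v"] sublinear_zero[of q] by simp

text \<open>Subadditivity survives the infimum because near-minimisers at \<open>u\<close> and at
  \<open>v\<close> are comparable: the smaller one is almost minimal at both points.\<close>

lemma sublinear_INF_chain:
  fixes C :: "('a::real_vector \<Rightarrow> real) set"
  assumes C: "C \<noteq> {}" and sub: "\<And>m. m \<in> C \<Longrightarrow> sublinear m"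
    and bdd: "\<And>v. bdd_below ((\<lambda>m. m v) ` C)"
    and chain: "\<And>m m'. m \<in> C \<Longrightarrow> m' \<in> C \<Longrightarrow> m \<le> m' \<or> m' \<le> m"
  shows "sublinear (\<lambda>v. INF m\<in>C. m v)"
proof (rule sublinearI)
  fix u v :: 'a
  show "(INF m\<in>C. m (u + v)) \<le> (INF m\<in>C. m u) + (INF m\<in>C. m v)"
  proof (rule field_le_epsilon)
    fix e :: real assume e: "e > 0"
    obtain a where a: "a \<in> C" "a u < (INF m\<in>C. m u) + e / 2"
      using cINF_less_iff[OF C bdd[of u], of "(INF m\<in>C. m u) + e / 2"] e by auto
    obtain b where b: "b \<in> C" "b v < (INF m\<in>C. m v) + e / 2"
      using cINF_less_iff[OF C bdd[of v], of "(INF m\<in>C. m v) + e / 2"] e by auto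
    obtain d where d: "d \<in> C" "d \<le> a" "d \<le> b"
      using chain[OF a(1) b(1)] a(1) b(1) by blast
    have "(INF m\<in>C. m (u + v)) \<le> d (u + v)"
      using bdd d(1) by (rule cINF_lower)
    also have "\<dots> \<le> d u + d v" using sub[OF d(1)] by (rule sublinear_add)
    also have "\<dots> \<le> a u + b v" using d by (auto intro: add_mono simp: le_fun_def)
    finally show "(INF m\<in>C. m (u + v)) \<le> (INF m\<in>C. m u) + (INF m\<in>C. m v) + e"
      using a b by simp
  qed
next
  fix c :: real and v :: 'a assume c: "c > 0"
  have "inverse c * (INF m\<in>C. m (c *\<^sub>R v)) \<le> (INF m\<in>C. m v)"
  proof (rule cINF_greatest[OF C])
    fix m assume m: "m \<in> C"
    have "(INF m\<in>C. m (c *\<^sub>R v)) \<le> m (c *\<^sub>R v)" using bdd m by (rule cINF_lower)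
    also have "\<dots> = c * m v" using sub[OF m] c by (simp add: sublinear_scaleR)
    finally show "inverse c * (INF m\<in>C. m (c *\<^sub>R v)) \<le> m v"
      using c by (simp add: field_simps)
  qed
  then show "(INF m\<in>C. m (c *\<^sub>R v)) \<le> c * (INF m\<in>C. m v)"
    using c by (simp add: field_simps)
next
  have "(\<lambda>m. m 0) ` C = {0}" using C sub by (auto simp: sublinear_zero)
  then show "(INF m\<in>C. m 0) = 0" by simp
qed

text \<open>Zorn's lemma for the reversed pointwise order. Infima of chains are finite since every
  sublinear \<open>m\<close> below \<open>q\<close> satisfies
  \<open>- q (- v) \<le> m v\<close>.\<close>

lemma minimal_sublinear_below:
  fixes q :: "'a::real_vector \<Rightarrow> real"
  assumes "sublinear q"
  shows "\<exists>m. sublinear m \<and> m \<le> q \<and> (\<forall>m'. sublinear m' \<and> m' \<le> m \<longrightarrow> m' = m)"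
proof -
  let ?A = "{m. sublinear m \<and> m \<le> q}" and ?P = "\<lambda>a b :: 'a \<Rightarrow> real. b \<le> a"
  have "\<exists>m\<in>?A. \<forall>a\<in>?A. ?P m a \<longrightarrow> a = m"
  proof (rule predicate_Zorn)
    show "partial_order_on ?A (relation_of ?P ?A)"
      by (rule partial_order_on_relation_ofI) auto
    fix C assume C: "C \<in> Chains (relation_of ?P ?A)"
    then have CA: "C \<subseteq> ?A" by (auto simp: Chains_def relation_of_def)
    show "\<exists>u\<in>?A. \<forall>a\<in>C. ?P a u"
    proof (cases "C = {}")
      case False
      have bdd: "bdd_below ((\<lambda>m. m v) ` C)" for v
      proof (rule bdd_belowI2)
        fix m assume "m \<in> C"
        with CA have m: "sublinear m" "m (- v) \<le> q (- v)" by (auto simp: le_fun_def)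
        with sublinear_minus[OF m(1), of v] show "- q (- v) \<le> m v" by linarith
      qed
      have "sublinear (\<lambda>v. INF m\<in>C. m v)"
        using False CA bdd C by (intro sublinear_INF_chain) (auto simp: Chains_def relation_of_def)
      moreover have lower: "(\<lambda>v. INF m\<in>C. m v) \<le> a" if "a \<in> C" for a
        using bdd that by (auto simp: le_fun_def intro: cINF_lower)
      moreover obtain a where a: "a \<in> C" "a \<le> q" using False CA by blast
      ultimately show ?thesis
        using order_trans[OF lower[OF a(1)] a(2)] by blast
    qed (use assms in auto)
  qed
  then obtain m where m: "m \<in> ?A" and min: "\<forall>a\<in>?A. a \<le> m \<longrightarrow> a = m"
    by blast
  have "m' = m" if "sublinear m'" "m' \<le> m" for m'
    using min that m order_trans[of m' m q] by blast
  with m show ?thesis by blast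
qed

text \<open>A minimal sublinear functional \<open>m\<close> is linear: it coincides with the smaller sublinear functional
  \<open>u \<mapsto> inf\<^sub>t (m (u + t v) - t m v)\<close>, which makes it superadditive.\<close>

theorem Hahn_Banach_sublinear:
  fixes q :: "'a::real_vector \<Rightarrow> real"
  assumes "sublinear q"
  obtains f where "linear f" "\<And>v. f v \<le> q v"
proof -
  obtain m where m: "sublinear m" "m \<le> q" and min: "\<And>m'. sublinear m' \<Longrightarrow> m' \<le> m \<Longrightarrow> m' = m"
    using minimal_sublinear_below[OF assms] by blast
  have super: "m u + m v \<le> m (u + v)" for u v
  proof -
    define g where "g u = (INF t\<in>{0..}. m (u + t *\<^sub>R v) - t * m v)" for u
    have lb: "- m (- u) \<le> m (u + t *\<^sub>R v) - t * m v" if "t \<ge> 0" for u t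
    proof -
      have "t * m v = m ((u + t *\<^sub>R v) + (- u))" using m that by (simp add: sublinear_scaleR)
      also have "\<dots> \<le> m (u + t *\<^sub>R v) + m (- u)" using m(1) by (rule sublinear_add)
      finally show ?thesis by simp
    qed
    have bdd: "bdd_below ((\<lambda>t. m (u + t *\<^sub>R v) - t * m v) ` {0..})" for u
      using lb by (intro bdd_belowI2) auto
    have g_le: "g u \<le> m (u + t *\<^sub>R v) - t * m v" if "t \<ge> 0" for u t
      unfolding g_def using that by (intro cINF_lower[OF bdd]) auto
    have g_ge: "c \<le> g u" if "\<And>t. t \<ge> 0 \<Longrightarrow> c \<le> m (u + t *\<^sub>R v) - t * m v" for c u
      unfolding g_def using that by (intro cINF_greatest) auto
    have "sublinear g"
    proof (rule sublinearI)
      fix x y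
      have "g (x + y) - (m (x + s *\<^sub>R v) - s * m v) \<le> m (y + t *\<^sub>R v) - t * m v"
        if "s \<ge> 0" "t \<ge> 0" for s t
      proof -
        have "g (x + y) \<le> m ((x + s *\<^sub>R v) + (y + t *\<^sub>R v)) - (s + t) * m v"
          using g_le[of "s + t" "x + y"] that by (simp add: algebra_simps)
        also have "\<dots> \<le> m (x + s *\<^sub>R v) + m (y + t *\<^sub>R v) - (s + t) * m v"
          using sublinear_add[OF m(1)] by simp
        finally show ?thesis by (simp add: algebra_simps)
      qed
      then have "g (x + y) - (m (x + s *\<^sub>R v) - s * m v) \<le> g y" if "s \<ge> 0" for s
        using that by (intro g_ge)
      then have "g (x + y) - g y \<le> g x"
        by (intro g_ge) (simp add: algebra_simps)
      then show "g (x + y) \<le> g x + g y" by simp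
    next
      fix c :: real and x assume c: "c > 0"
      have "inverse c * g (c *\<^sub>R x) \<le> g x"
      proof (rule g_ge)
        fix t :: real assume t: "t \<ge> 0"
        have "g (c *\<^sub>R x) \<le> m (c *\<^sub>R (x + t *\<^sub>R v)) - (c * t) * m v"
          using g_le[of "c * t" "c *\<^sub>R x"] t c by (simp add: scaleR_add_right)
        also have "\<dots> = c * (m (x + t *\<^sub>R v) - t * m v)"
          using sublinear_scaleR[OF m(1), of c "x + t *\<^sub>R v"] c by (simp add: algebra_simps)
        finally show "inverse c * g (c *\<^sub>R x) \<le> m (x + t *\<^sub>R v) - t * m v"
          using c by (simp add: field_simps)
      qed
      then show "g (c *\<^sub>R x) \<le> c * g x" using c by (simp add: field_simps)
    next
      have "g 0 \<le> 0" using g_le[of 0 0] sublinear_zero[OF m(1)] by simp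
      moreover have "0 \<le> g 0"
        using m(1) by (intro g_ge) (simp add: sublinear_scaleR)
      ultimately show "g 0 = 0" by simp
    qed
    moreover have "g \<le> m" using g_le[of 0] by (simp add: le_fun_def)
    ultimately have "g = m" by (rule min)
    \<comment> \<open>Taking \<open>t = 1\<close> in the infimum turns \<open>g = m\<close> into
      \<open>m u \<le> m (u + v) - m v\<close>.\<close>
    with g_le[of 1 u] show ?thesis by simp
  qed
  have add: "m (u + v) = m u + m v" for u v
    using super sublinear_add[OF m(1)] by (simp add: order_antisym)
  have neg: "m (- v) = - m v" for v
    using add[of v "- v"] sublinear_zero[OF m(1)] by simp
  have "linear m"
  proof (rule linearI)
    show "m (u + v) = m u + m v" for u v by (rule add)
    show "m (c *\<^sub>R v) = c *\<^sub>R m v" for c v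
    proof (cases "c \<ge> 0")
      case False
      then have "m ((- c) *\<^sub>R v) = (- c) * m v" using m(1) by (intro sublinear_scaleR) auto
      then show ?thesis using neg[of "c *\<^sub>R v"] by simp
    qed (use m(1) in \<open>simp add: sublinear_scaleR\<close>)
  qed
  with m(2) show ?thesis using that by (auto simp: le_fun_def)
qed

text \<open>Apply Hahn-Banach to \<open>q v = inf (norm (v + t c) - t d)\<close> over \<open>t \<ge> 0\<close> and \<open>c \<in> C\<close>.\<close>

lemma convex_separation_from_zero:
  fixes C :: "'a::real_normed_vector set"
  assumes "convex C" "C \<noteq> {}" and d: "\<And>c. c \<in> C \<Longrightarrow> d \<le> norm c"
  obtains f :: "'a \<Rightarrow>\<^sub>L real" where "norm f \<le> 1" "\<And>c. c \<in> C \<Longrightarrow> d \<le> f c"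
proof -
  define I where "I = {0::real..} \<times> C"
  have I: "I \<noteq> {}" using assms by (auto simp: I_def)
  define h where "h = (\<lambda>(v::'a) (t, c). norm (v + t *\<^sub>R c) - t * d)"
  define q where "q v = (INF i\<in>I. h v i)" for v
  \<comment> \<open>The infimum is finite because the penalty \<open>t * d\<close> never exceeds
    \<open>norm (t *\<^sub>R c)\<close>.\<close>
  have lb: "- norm v \<le> h v i" if "i \<in> I" for v i
  proof -
    obtain t c where i: "i = (t, c)" "t \<ge> 0" "c \<in> C" using \<open>i \<in> I\<close> by (auto simp: I_def)
    have "t * d \<le> norm (t *\<^sub>R c)" using d[OF i(3)] i(2) by (simp add: mult_left_mono)
    also have "\<dots> \<le> norm (v + t *\<^sub>R c) + norm v"
      using norm_triangle_ineq4[of "v + t *\<^sub>R c" v] by simp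
    finally show ?thesis by (simp add: h_def i)
  qed
  have bdd: "bdd_below (h v ` I)" for v using lb by (intro bdd_belowI2)
  have q_le: "q v \<le> h v i" if "i \<in> I" for v i
    unfolding q_def using that by (intro cINF_lower[OF bdd])
  have q_ge: "c \<le> q v" if "\<And>i. i \<in> I \<Longrightarrow> c \<le> h v i" for c v
    unfolding q_def using that I by (intro cINF_greatest) auto
  obtain c0 where c0: "c0 \<in> C" using assms by auto
  have q_norm: "q v \<le> norm v" for v
    using q_le[of "(0, c0)" v] c0 by (simp add: h_def I_def)
  have "sublinear q"
  proof (rule sublinearI)
    fix u v
    have key: "q (u + v) - h u i \<le> h v j" if "i \<in> I" "j \<in> I" for i j
    proof -
      obtain s a where i: "i = (s, a)" "s \<ge> 0" "a \<in> C" using \<open>i \<in> I\<close> by (auto simp: I_def)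
      obtain t b where j: "j = (t, b)" "t \<ge> 0" "b \<in> C" using \<open>j \<in> I\<close> by (auto simp: I_def)
      \<comment> \<open>Convexity enters here: the mean of \<open>a\<close> and \<open>b\<close>
        with weights \<open>s\<close> and \<open>t\<close> makes \<open>(s + t, e)\<close> an
        admissible pair.\<close>
      obtain e where e: "e \<in> C" "(s + t) *\<^sub>R e = s *\<^sub>R a + t *\<^sub>R b"
      proof (cases "s + t = 0")
        case True
        with i j have "s = 0" "t = 0" by auto
        with c0 show ?thesis by (intro that[of c0]) auto
      next
        case False
        have "(s / (s + t)) *\<^sub>R a + (t / (s + t)) *\<^sub>R b \<in> C"
          using assms(1) i j False by (intro convexD) (auto simp: add_divide_distrib[symmetric])
        with False show ?thesis
          by (intro that[of "(s / (s + t)) *\<^sub>R a + (t / (s + t)) *\<^sub>R b"]) (auto simp: scaleR_add_right)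
      qed
      have "q (u + v) \<le> norm ((u + s *\<^sub>R a) + (v + t *\<^sub>R b)) - (s + t) * d"
        using q_le[of "(s + t, e)" "u + v"] e i j by (simp add: I_def h_def algebra_simps)
      also have "\<dots> \<le> norm (u + s *\<^sub>R a) + norm (v + t *\<^sub>R b) - (s + t) * d"
        using norm_triangle_ineq by auto
      finally show ?thesis by (simp add: h_def i j algebra_simps)
    qed
    have "q (u + v) - h u i \<le> q v" if "i \<in> I" for i using key[OF that] by (intro q_ge)
    then have "q (u + v) - q v \<le> q u" by (intro q_ge) (simp add: algebra_simps)
    then show "q (u + v) \<le> q u + q v" by simp
  next
    fix c :: real and v assume c: "c > 0"
    have "inverse c * q (c *\<^sub>R v) \<le> q v"
    proof (rule q_ge)
      fix i assume "i \<in> I"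
      then obtain t a where i: "i = (t, a)" "t \<ge> 0" "a \<in> C" by (auto simp: I_def)
      have "q (c *\<^sub>R v) \<le> norm (c *\<^sub>R (v + t *\<^sub>R a)) - c * t * d"
        using q_le[of "(c * t, a)" "c *\<^sub>R v"] i c by (simp add: I_def h_def scaleR_add_right)
      also have "\<dots> = c * h v i"
        unfolding norm_scaleR using c by (simp add: h_def i right_diff_distrib)
      finally show "inverse c * q (c *\<^sub>R v) \<le> h v i" using c by (simp add: field_simps)
    qed
    then show "q (c *\<^sub>R v) \<le> c * q v" using c by (simp add: field_simps)
  next
    have "q 0 \<le> 0" using q_norm[of 0] by simp
    moreover have "0 \<le> q 0" using lb[of _ 0] by (intro q_ge) simp
    ultimately show "q 0 = 0" by simp
  qed
  then obtain f where f: "linear f" "\<And>v. f v \<le> q v" using Hahn_Banach_sublinear by blast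
  have le: "\<bar>f v\<bar> \<le> norm v" for v
    using f(2)[of v] f(2)[of "- v"] q_norm[of v] q_norm[of "- v"] linear_neg[OF f(1), of v] by simp
  have bl: "bounded_linear f"
    using f(1) le by (intro bounded_linear_intro[where K = 1])
      (auto simp: linear_add linear_scale)
  have "d \<le> f c" if "c \<in> C" for c
  proof -
    \<comment> \<open>At the point \<open>- c\<close> the pair \<open>(1, c)\<close> gives
      \<open>h\<close> the value \<open>- d\<close>.\<close>
    have "- f c = f (- c)" using linear_neg[OF f(1)] by simp
    also have "\<dots> \<le> h (- c) (1, c)"
      using f(2)[of "- c"] q_le[of "(1, c)" "- c"] that by (simp add: I_def)
    finally show ?thesis by (simp add: h_def)
  qed
  moreover have "norm (Blinfun f) \<le> 1"
    using le by (intro norm_blinfun_bound) (auto simp: bounded_linear_Blinfun_apply[OF bl])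
  ultimately show ?thesis
    using that[of "Blinfun f"] by (simp add: bounded_linear_Blinfun_apply[OF bl])
qed

section \<open>Norming functionals and separation from closed convex sets\<close>

lemma norming_functional:
  fixes x :: "'a::real_normed_vector"
  obtains f :: "'a \<Rightarrow>\<^sub>L real" where "norm f \<le> 1" "f x = norm x"
proof -
  obtain f :: "'a \<Rightarrow>\<^sub>L real" where f: "norm f \<le> 1" "norm x \<le> f x"
    using convex_separation_from_zero[of "{x}" "norm x"] by auto
  have "\<bar>f x\<bar> \<le> 1 * norm x"
    using order_trans[OF norm_blinfun[of f x] mult_right_mono[OF f(1)]] by simp
  with f show ?thesis using that by auto
qed

text \<open>A point off the closure has positive distance \<open>d\<close> from \<open>A\<close>, so
  the convex set of all \<open>x - a\<close> can be separated from zero with gap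
  \<open>d\<close>.\<close>

lemma separate_point_closure_convex:
  fixes x :: "'a::real_normed_vector"
  assumes "convex A" "x \<notin> closure A"
  obtains f :: "'a \<Rightarrow>\<^sub>L real" and c where "c < f x" "\<And>a. a \<in> A \<Longrightarrow> f a \<le> c"
proof (cases "A = {}")
  case True
  then show ?thesis using that[of "-1" 0] by simp
next
  case False
  obtain d where d: "d > 0" "\<And>a. a \<in> A \<Longrightarrow> d \<le> dist a x"
    using assms(2) by (auto simp: closure_approachable not_less)
  have "convex ((\<lambda>a. x - a) ` A)"
    using convex_translation[OF convex_negations[OF assms(1)], of x] by (simp add: image_image)
  then obtain f :: "'a \<Rightarrow>\<^sub>L real" where "\<And>c. c \<in> (\<lambda>a. x - a) ` A \<Longrightarrow> d \<le> f c"
    by (rule convex_separation_from_zero) (use d False in \<open>auto simp: dist_norm norm_minus_commute\<close>)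
  then have f: "\<And>a. a \<in> A \<Longrightarrow> d \<le> f (x - a)" by blast
  show ?thesis
  proof (rule that[of "f x - d" f])
    show "f x - d < f x" using d by simp
    show "f a \<le> f x - d" if "a \<in> A" for a using f[OF that] by (simp add: blinfun.diff_right)
  qed
qed

section \<open>Small slices of weakly compact sets\<close>

text \<open>A sequence of finite convex combinations converging to \<open>x\<close> involves only
  countably many points of \<open>A\<close>.\<close>

lemma closure_convex_hull_countable:
  fixes x :: "'a::real_normed_vector"
  assumes "x \<in> closure (convex hull A)"
  obtains E where "countable E" "E \<subseteq> A" "x \<in> closure (convex hull E)"
proof -
  have "\<exists>F y. finite F \<and> F \<subseteq> A \<and> y \<in> convex hull F \<and> dist y x < 1 / Suc n" for n
  proof -
    obtain y where y: "y \<in> convex hull A" "dist y x < 1 / Suc n"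
      using assms by (metis closure_approachable of_nat_0_less_iff zero_less_Suc zero_less_divide_1_iff)
    then obtain F where "finite F" "F \<subseteq> A" "y \<in> convex hull F"
      unfolding convex_hull_explicit[of A] by (auto simp: convex_hull_finite)
    with y show ?thesis by blast
  qed
  then obtain F y where F: "\<And>n. finite (F n)" "\<And>n. F n \<subseteq> A" "\<And>n. y n \<in> convex hull F n"
    "\<And>n. dist (y n) x < 1 / Suc n"
    by metis
  show ?thesis
  proof (rule that[of "\<Union>n. F n"])
    show "countable (\<Union>n. F n)" using F(1) by (auto intro: countable_finite)
    show "(\<Union>n. F n) \<subseteq> A" using F(2) by auto
    have "y n \<in> convex hull (\<Union>n. F n)" for n
      using F(3)[of n] hull_mono[of "F n" "\<Union>n. F n"] by blast
    moreover have "y \<longlonglongrightarrow> x"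
    proof (rule metric_LIMSEQ_I)
      fix e :: real assume "e > 0"
      then obtain N where N: "1 / Suc N < e" by (metis nat_approx_posE)
      have "dist (y n) x < e" if "n \<ge> N" for n
      proof -
        have "1 / Suc n \<le> 1 / Suc N" using that by (simp add: frac_le)
        with F(4)[of n] N show ?thesis by linarith
      qed
      then show "\<exists>N. \<forall>n\<ge>N. dist (y n) x < e" by blast
    qed
    ultimately show "x \<in> closure (convex hull (\<Union>n. F n))"
      by (auto simp: closure_sequential)
  qed
qed

text \<open>Rational linear combinations of \<open>D\<close> do it: their closure is even a linear
  subspace. They serve as centres of the countably many balls in the Baire argument, and convexity
  of the closure lets separation show that it contains the weak limits of \<open>D\<close> used
  there.\<close>

lemma countable_dense_in_convex_closure:
  fixes D :: "'a::real_normed_vector set"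
  assumes "countable D"
  obtains Q where "countable Q" "D \<subseteq> Q" "convex (closure Q)"
proof -
  define comb where "comb l = sum_list (map (\<lambda>(q, d). of_rat q *\<^sub>R d) l)" for l :: "(rat \<times> 'a) list"
  define Q where "Q = comb ` lists (UNIV \<times> D)"
  have add: "x + y \<in> Q" if xy: "x \<in> Q" "y \<in> Q" for x y
  proof -
    obtain l l' where "l \<in> lists (UNIV \<times> D)" "l' \<in> lists (UNIV \<times> D)" "x = comb l" "y = comb l'"
      using xy by (auto simp: Q_def)
    then have "x + y = comb (l @ l')" "l @ l' \<in> lists (UNIV \<times> D)" by (auto simp: comb_def)
    then show ?thesis unfolding Q_def by blast
  qed
  have scale: "c *\<^sub>R x \<in> Q" if xy: "x \<in> Q" "c \<in> \<rat>" for x c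
  proof -
    obtain l where l: "l \<in> lists (UNIV \<times> D)" "x = comb l" using xy by (auto simp: Q_def)
    obtain r where r: "c = of_rat r" using xy by (auto elim: Rats_cases)
    let ?l = "map (\<lambda>(q, d). (r * q, d)) l"
    have "comb ?l = c *\<^sub>R comb l"
      by (induction l) (auto simp: comb_def r of_rat_mult scaleR_add_right)
    moreover have "?l \<in> lists (UNIV \<times> D)" using l by auto
    ultimately show ?thesis using l unfolding Q_def by (metis imageI)
  qed
  have "(\<lambda>(x, y). x + y) ` closure (Q \<times> Q) \<subseteq> closure Q"
    by (rule image_closure_subset)
      (use add closure_subset[of Q] in \<open>auto intro!: continuous_intros simp: case_prod_unfold\<close>)
  then have cadd: "x + y \<in> closure Q" if "x \<in> closure Q" "y \<in> closure Q" for x y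
    using that by (auto simp: closure_Times)
  have closure_rat: "closure \<rat> = (UNIV :: real set)"
  proof -
    have "x \<in> closure \<rat>" for x :: real
      unfolding closure_approachable
    proof (intro allI impI)
      fix e :: real assume "e > 0"
      then obtain r where "r \<in> \<rat>" "x < r" "r < x + e" using Rats_dense_in_real[of x "x + e"] by auto
      then show "\<exists>r\<in>\<rat>. dist r x < e" by (intro bexI[of _ r]) (auto simp: dist_real_def)
    qed
    then show ?thesis by auto
  qed
  have "(\<lambda>(c, y). c *\<^sub>R y) ` closure (\<rat> \<times> Q) \<subseteq> closure Q"
    by (rule image_closure_subset)
      (use scale closure_subset[of Q] in \<open>auto intro!: continuous_intros simp: case_prod_unfold\<close>)
  then have cscale: "c *\<^sub>R x \<in> closure Q" if "x \<in> closure Q" for x c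
    using that by (auto simp: closure_Times closure_rat)
  show ?thesis
  proof (rule that)
    show "countable Q" using assms by (simp add: Q_def)
    show "D \<subseteq> Q"
    proof
      fix d assume "d \<in> D"
      then have "[(1, d)] \<in> lists (UNIV \<times> D)" "d = comb [(1, d)]" by (auto simp: comb_def)
      then show "d \<in> Q" unfolding Q_def by blast
    qed
    show "convex (closure Q)" by (auto intro!: convexI cadd cscale)
  qed
qed

text \<open>The functionals that attain their supremum over \<open>D\<close>, up to every \<open>\<eta>\<close>, inside a fixed small ball
  form a closed set \<open>F n\<close>; by weak compactness and separability countably many of these sets cover
  the dual. A functional in the interior of some \<open>F n\<close> can be tilted towards any point of a thin
  slice, so the slice cannot leave that ball by much.\<close>

lemma countable_small_slice:
  fixes T :: "'a::banach topology"
  assumes cont: "\<And>f :: 'a \<Rightarrow>\<^sub>L real. continuous_map T euclideanreal f"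
    and K: "compactin T K" "D \<subseteq> K" and D: "countable D" "bounded D"
    and x0: "x0 \<in> D" and m: "0 \<le> m" "m < norm x0" and \<epsilon>: "\<epsilon> > 0"
  obtains f :: "'a \<Rightarrow>\<^sub>L real" and c x z where "x \<in> D" "c < f x" "m * norm f \<le> c"
    "\<forall>s\<in>D. c < f s \<longrightarrow> norm (s - z) \<le> \<epsilon>"
proof -
  \<comment> \<open>Compactness of \<open>W\<close> lets functionals attain their suprema on it, and
    density of \<open>D\<close> in \<open>W\<close> for \<open>T\<close> makes these the suprema
    over \<open>D\<close>.\<close>
  define W where "W = K \<inter> T closure_of D"
  have W: "compactin T W" unfolding W_def by (intro compact_Int_closedin K) simp
  have top: "K \<subseteq> topspace T" using K(1) by (rule compactin_subset_topspace)
  have DW: "D \<subseteq> W" using K(2) top closure_of_subset[of D T] by (auto simp: W_def)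
  have approx: "\<exists>d\<in>D. c < f d" if "w \<in> W" "c < f w" for f :: "'a \<Rightarrow>\<^sub>L real" and w c
  proof -
    define V where "V = {y \<in> topspace T. f y \<in> {c<..}}"
    have V: "openin T V"
      unfolding V_def by (rule openin_continuous_map_preimage[OF cont]) simp
    have "w \<in> K" and w: "w \<in> T closure_of D" using that(1) by (simp_all add: W_def)
    then have "w \<in> V" using that(2) top by (auto simp: V_def)
    with V w have "\<exists>y. y \<in> D \<and> y \<in> V" unfolding in_closure_of by simp
    then show ?thesis by (auto simp: V_def)
  qed
  have attain: "\<exists>w\<in>W. \<forall>v\<in>W. f v \<le> f w" for f :: "'a \<Rightarrow>\<^sub>L real"
  proof -
    have "compact (blinfun_apply f ` W)" using image_compactin[OF W cont] by simp
    moreover have "blinfun_apply f ` W \<noteq> {}" using DW x0 by auto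
    ultimately show ?thesis using compact_attains_sup[of "blinfun_apply f ` W"] by auto
  qed
  obtain Q where Q: "countable Q" "D \<subseteq> Q" "convex (closure Q)"
    using countable_dense_in_convex_closure[OF D(1)] .
  have WQ: "W \<subseteq> closure Q"
  proof
    fix w assume w: "w \<in> W"
    show "w \<in> closure Q"
    proof (rule ccontr)
      assume "w \<notin> closure Q"
      then have "w \<notin> closure (closure Q)" by simp
      then obtain f :: "'a \<Rightarrow>\<^sub>L real" and c where f: "c < f w" "\<And>a. a \<in> closure Q \<Longrightarrow> f a \<le> c"
        using separate_point_closure_convex[OF Q(3)] by blast
      obtain d where "d \<in> D" "c < f d" using approx[OF w f(1)] by blast
      with f(2)[of d] Q(2) closure_subset[of Q] show False by auto
    qed
  qed
  define q where "q = from_nat_into Q"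
  have q: "range q = Q" unfolding q_def using Q x0 by (intro range_from_nat_into) auto
  \<comment> \<open>Points of the slice end up within \<open>2 * r\<close> of \<open>q n\<close>:
    one \<open>r\<close> is the radius of the ball, the other the error of the tilting
    argument.\<close>
  define r where "r = \<epsilon> / 2"
  have r: "r > 0" using \<epsilon> by (simp add: r_def)
  \<comment> \<open>Asking for every \<open>\<eta>\<close> instead of attainment makes closedness a
    matter of uniform approximation on bounded sets.\<close>
  define F where
    "F n = {f :: 'a \<Rightarrow>\<^sub>L real. \<forall>\<eta>>0. \<exists>w\<in>W \<inter> cball (q n) r. \<forall>d\<in>D. f d \<le> f w + \<eta>}" for n
  obtain B where B: "\<And>d. d \<in> D \<Longrightarrow> norm d \<le> B" using D(2) by (auto simp: bounded_iff)
  have closed: "closed (F n)" for n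
  proof -
    have "f \<in> F n" if f: "f \<in> closure (F n)" for f
      unfolding F_def
    proof (intro CollectI allI impI)
      fix \<eta> :: real assume \<eta>: "\<eta> > 0"
      \<comment> \<open>\<open>L\<close> bounds the norms on \<open>D\<close> and on the ball around
        \<open>q n\<close>. Passing from \<open>g\<close> to \<open>f\<close> then costs
        \<open>\<eta> / 3\<close> at \<open>d\<close> and at \<open>w\<close>, and the last third is
        the defect of \<open>g\<close>.\<close>
      define L where "L = \<bar>B\<bar> + norm (q n) + r + 1"
      have L: "L > 0" using r by (simp add: L_def add_nonneg_pos)
      obtain g where g: "g \<in> F n" "dist g f < \<eta> / (3 * L)"
        using f \<eta> L by (meson closure_approachable divide_pos_pos mult_pos_pos zero_less_numeral)
      have close: "\<bar>f y - g y\<bar> \<le> \<eta> / 3" if "norm y \<le> L" for y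
      proof -
        have "\<bar>f y - g y\<bar> \<le> norm (f - g) * norm y"
          using norm_blinfun[of "f - g" y] by (simp add: blinfun.diff_left)
        also have "\<dots> \<le> (\<eta> / (3 * L)) * L"
          using g(2) that \<eta> L by (intro mult_mono) (auto simp: dist_norm norm_minus_commute)
        finally show ?thesis using L by simp
      qed
      obtain w where w: "w \<in> W \<inter> cball (q n) r" "\<And>d. d \<in> D \<Longrightarrow> g d \<le> g w + \<eta> / 3"
        using g(1) \<eta> unfolding F_def by (smt (verit) divide_pos_pos mem_Collect_eq)
      have "norm w \<le> norm (q n) + r"
        using w(1) norm_triangle_sub[of w "q n"] by (auto simp: dist_norm norm_minus_commute)
      then have fw: "\<bar>f w - g w\<bar> \<le> \<eta> / 3" by (intro close) (simp add: L_def)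
      have "f d \<le> f w + \<eta>" if "d \<in> D" for d
      proof -
        have "norm d \<le> L"
          using B[OF that] r norm_ge_zero[of "q n"] abs_ge_self[of B] unfolding L_def by linarith
        then have "\<bar>f d - g d\<bar> \<le> \<eta> / 3" by (rule close)
        with fw w(2)[OF that] \<eta> show ?thesis by linarith
      qed
      with w(1) show "\<exists>w\<in>W \<inter> cball (q n) r. \<forall>d\<in>D. f d \<le> f w + \<eta>" by blast
    qed
    then show ?thesis by (metis closure_subset closure_subset_eq subsetI)
  qed
  have cover: "\<exists>n. f \<in> F n" for f
  proof -
    obtain w where w: "w \<in> W" "\<And>v. v \<in> W \<Longrightarrow> f v \<le> f w" using attain[of f] by blast
    obtain y where "y \<in> Q" "dist y w < r" using w(1) WQ r by (meson closure_approachable subsetD)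
    then obtain n where "dist (q n) w < r" using q by auto
    with w DW have "f \<in> F n" unfolding F_def by (fastforce intro!: bexI[of _ w])
    then show ?thesis ..
  qed
  obtain f0 :: "'a \<Rightarrow>\<^sub>L real" where f0: "norm f0 \<le> 1" "f0 x0 = norm x0"
    using norming_functional[of x0] .
  \<comment> \<open>An open condition satisfied by \<open>f0\<close>. Baire's theorem is applied
    inside a ball contained in \<open>U\<close>, so the functional found there keeps
    \<open>x0\<close> above the level \<open>m * norm f\<close>.\<close>
  define U where "U = {f :: 'a \<Rightarrow>\<^sub>L real. m * norm f < blinfun_apply f x0}"
  have "open U" unfolding U_def by (intro open_Collect_less continuous_intros)
  moreover have "f0 \<in> U"
    using mult_left_mono[OF f0(1) m(1)] f0(2) m(2) by (simp add: U_def)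
  ultimately obtain e where e: "e > 0" "cball f0 e \<subseteq> U" using open_contains_cball by metis
  obtain n f where f: "f \<in> interior (F n \<inter> cball f0 e)"
  proof (rule ccontr)
    have interior_of_euclidean: "euclidean interior_of A = interior A" for A :: "('a \<Rightarrow>\<^sub>L real) set"
      by (auto simp: interior_of_def interior_def)
    assume "\<not> thesis"
    with that have "interior (F n \<inter> cball f0 e) = {}" for n by blast
    then have "euclidean interior_of \<Union>(range (\<lambda>n. F n \<inter> cball f0 e)) = {}"
      using closed by (intro Baire_category_alt)
        (auto simp: completely_metrizable_space_euclidean interior_of_euclidean closed_Int)
    moreover have "\<Union>(range (\<lambda>n. F n \<inter> cball f0 e)) = cball f0 e" using cover by auto
    ultimately have "interior (cball f0 e) = {}" unfolding interior_of_euclidean by argo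
    moreover have "ball f0 e \<subseteq> interior (cball f0 e)" by (rule interior_maximal) auto
    ultimately show False using e(1) centre_in_ball[of f0 e] by blast
  qed
  then have "f \<in> U" using interior_subset e(2) by blast
  then have fU: "m * norm f < f x0" by (simp add: U_def)
  obtain \<rho> where \<rho>: "\<rho> > 0" "ball f \<rho> \<subseteq> F n"
    using f by (auto simp: mem_interior)
  \<comment> \<open>\<open>t < \<rho>\<close> keeps the tilted functional in \<open>F n\<close>. Two
    errors \<open>\<delta>\<close> occur below; together they are \<open>t * r\<close>, which is
    \<open>r\<close> after division by \<open>t\<close>.\<close>
  define t where "t = \<rho> / 2"
  define \<delta> where "\<delta> = t * r / 2"
  have t: "t > 0" "t < \<rho>" and \<delta>: "\<delta> > 0" using \<rho> r by (auto simp: t_def \<delta>_def)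
  obtain w where w: "w \<in> W" "\<And>v. v \<in> W \<Longrightarrow> f v \<le> f w" using attain[of f] by blast
  \<comment> \<open>The first entry makes the slice thin; the second keeps points of norm at most
    \<open>m\<close> out of it.\<close>
  define c where "c = max (f w - \<delta>) (m * norm f)"
  have "c < f w" using \<delta> fU w(2)[of x0] x0 DW by (auto simp: c_def)
  then obtain x where x: "x \<in> D" "c < f x" using approx[OF w(1)] by blast
  show ?thesis
  proof (rule that[OF x], safe)
    show "m * norm f \<le> c" unfolding c_def by (rule max.cobounded2)
    fix s assume s: "s \<in> D" "c < f s"
    obtain h :: "'a \<Rightarrow>\<^sub>L real" where h: "norm h \<le> 1" "h (s - q n) = norm (s - q n)"
      using norming_functional[of "s - q n"] .
    have "norm (t *\<^sub>R h) \<le> t" using h(1) t by (simp add: mult_left_le)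
    moreover have "dist f (f + t *\<^sub>R h) = norm (t *\<^sub>R h)" by (simp add: dist_norm)
    ultimately have "dist f (f + t *\<^sub>R h) < \<rho>" using t by linarith
    then have "f + t *\<^sub>R h \<in> F n" using \<rho>(2) by auto
    then obtain v where "v \<in> W \<inter> cball (q n) r" "\<forall>d\<in>D. (f + t *\<^sub>R h) d \<le> (f + t *\<^sub>R h) v + \<delta>"
      using \<delta> unfolding F_def by blast
    then have v: "v \<in> W" "norm (v - q n) \<le> r" "(f + t *\<^sub>R h) s \<le> (f + t *\<^sub>R h) v + \<delta>"
      using s(1) dist_commute[of v "q n"] by (simp_all add: dist_norm[symmetric])
    have "f v \<le> f s + \<delta>" using w(2)[OF v(1)] s(2) by (simp add: c_def)
    with v(3) have "t * h s \<le> t * h v + t * r"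
      by (simp add: blinfun.add_left blinfun.scaleR_left \<delta>_def)
    then have "t * h s \<le> t * (h v + r)" by (simp add: distrib_left)
    then have "h s \<le> h v + r" using t by simp
    moreover have "h (v - q n) \<le> r"
      using order_trans[OF norm_blinfun[of h "v - q n"] mult_mono[OF h(1) v(2)]] by simp
    ultimately have "norm (s - q n) \<le> 2 * r" using h(2) by (simp add: blinfun.diff_right)
    then show "norm (s - q n) \<le> \<epsilon>" by (simp add: r_def)
  qed
qed

text \<open>Reduction to a countable set: if no slice were small, every point of large norm would be in the
  closed convex hull of countably many points at distance more than \<open>\<epsilon>\<close>. Closing a single point
  under this operation gives a countable set contradicting the previous lemma.\<close>

theorem small_slice:
  fixes T :: "'a::banach topology"
  assumes cont: "\<And>f :: 'a \<Rightarrow>\<^sub>L real. continuous_map T euclideanreal f"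
    and K: "compactin T K" "S \<subseteq> K" and S: "bounded S"
    and x0: "x0 \<in> S" and m: "0 \<le> m" "m < norm x0" and \<epsilon>: "\<epsilon> > 0"
  obtains f :: "'a \<Rightarrow>\<^sub>L real" and c x where "x \<in> S" "m < norm x" "c < f x"
    "\<forall>s\<in>S. c < f s \<longrightarrow> norm (s - x) \<le> \<epsilon>"
proof (rule ccontr)
  note found = that
  assume contr: "\<not> thesis"
  have "\<exists>E. countable E \<and> E \<subseteq> S - cball x \<epsilon> \<and> x \<in> closure (convex hull E)"
    if x: "x \<in> S" "m < norm x" for x
  proof -
    have "x \<in> closure (convex hull (S - cball x \<epsilon>))"
    proof (rule ccontr)
      assume "x \<notin> closure (convex hull (S - cball x \<epsilon>))"
      then obtain f :: "'a \<Rightarrow>\<^sub>L real" and c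
        where f: "c < f x" "\<And>a. a \<in> convex hull (S - cball x \<epsilon>) \<Longrightarrow> f a \<le> c"
        using separate_point_closure_convex[OF convex_convex_hull] by blast
      have slice: "norm (s - x) \<le> \<epsilon>" if "s \<in> S" "c < f s" for s
      proof (rule ccontr)
        assume "\<not> norm (s - x) \<le> \<epsilon>"
        with that have "s \<in> S - cball x \<epsilon>" by (simp add: dist_norm norm_minus_commute)
        then have "f s \<le> c" by (intro f(2) hull_inc)
        with that show False by simp
      qed
      from contr show False by (rule notE) (rule found[OF x f(1)], use slice in blast)
    qed
    then obtain E where "countable E" "E \<subseteq> S - cball x \<epsilon>" "x \<in> closure (convex hull E)"
      by (rule closure_convex_hull_countable)
    then show ?thesis by blast
  qed
  then have "\<forall>x\<in>{x \<in> S. m < norm x}. \<exists>E. countable E \<and> E \<subseteq> S - cball x \<epsilon> \<and> x \<in> closure (convex hull E)"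
    by simp
  then obtain E where
    E: "\<forall>x\<in>{x \<in> S. m < norm x}. countable (E x) \<and> E x \<subseteq> S - cball x \<epsilon> \<and> x \<in> closure (convex hull E x)"
    by (rule bchoice[THEN exE])
  define D where "D n = ((\<lambda>A. \<Union>x\<in>{x \<in> A. m < norm x}. E x) ^^ n) {x0}" for n
  have D_Suc: "D (Suc n) = (\<Union>x\<in>{x \<in> D n. m < norm x}. E x)" for n by (simp add: D_def)
  have D: "D n \<subseteq> S \<and> countable (D n)" for n
  proof (induction n)
    case 0 show ?case using x0 by (simp add: D_def)
  next
    case (Suc n)
    have "countable {x \<in> D n. m < norm x}" 
      by (rule countable_subset[of _ "D n"]) (use Suc in auto)
    moreover have "countable (E x)" "E x \<subseteq> S" if "x \<in> {x \<in> D n. m < norm x}" for x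
      using that E Suc by auto
    ultimately show ?case unfolding D_Suc by (intro conjI UN_least countable_UN) auto
  qed
  define U where "U = (\<Union>n. D n)"
  have U: "U \<subseteq> S" "countable U" "x0 \<in> U"
  proof -
    have "x0 \<in> D 0" by (simp add: D_def)
    then show "U \<subseteq> S" "countable U" "x0 \<in> U" using D by (auto simp: U_def)
  qed
  \<comment> \<open>The centre \<open>z\<close> supplied by the countable case need not be the point
    \<open>x\<close>. Radius \<open>\<epsilon> / 2\<close> puts any two points of the slice within
    \<open>\<epsilon>\<close> of each other.\<close>
  note slice_of_U = countable_small_slice[OF cont K(1) order_trans[OF U(1) K(2)] U(2)
      bounded_subset[OF S U(1)] U(3) m, of "\<epsilon> / 2"]
  have "\<epsilon> / 2 > 0" using \<epsilon> by simp
  then obtain f :: "'a \<Rightarrow>\<^sub>L real" and c x z where f: "x \<in> U" "c < f x" "m * norm f \<le> c"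
    and slice: "\<forall>s\<in>U. c < f s \<longrightarrow> norm (s - z) \<le> \<epsilon> / 2"
    by (rule slice_of_U)
  \<comment> \<open>The bound \<open>m * norm f \<le> c\<close> places \<open>x\<close> among the
    points to which the choice \<open>E\<close> applies.\<close>
  have "m < norm x"
  proof (rule ccontr)
    assume "\<not> m < norm x"
    then have "norm f * norm x \<le> norm f * m" by (intro mult_left_mono) auto
    moreover have "f x \<le> norm f * norm x" using norm_blinfun[of f x] by simp
    ultimately show False using f(2,3) unfolding mult.commute[of m] by linarith
  qed
  with subsetD[OF U(1) f(1)] have "x \<in> {x \<in> S. m < norm x}" by (intro CollectI conjI)
  note Ex = bspec[OF E this, THEN conjunct2, THEN conjunct1] bspec[OF E this, THEN conjunct2, THEN conjunct2]
  obtain n where "x \<in> D n" using f(1) by (auto simp: U_def)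
  with \<open>m < norm x\<close> have "E x \<subseteq> D (Suc n)" unfolding D_Suc by blast
  then have "E x \<subseteq> U" by (auto simp: U_def)
  \<comment> \<open>Points of \<open>E x\<close> are farther than \<open>\<epsilon>\<close> from
    \<open>x\<close>, hence outside the slice. A closed half-space missing \<open>x\<close> thus
    contains \<open>E x\<close>, although \<open>x\<close> lies in its closed convex hull.\<close>
  have "f s \<le> c" if s: "s \<in> E x" for s
  proof (rule ccontr)
    assume "\<not> f s \<le> c"
    then have "norm (s - z) \<le> \<epsilon> / 2" using s \<open>E x \<subseteq> U\<close> slice by auto
    then have "dist x s \<le> \<epsilon>"
      using slice[rule_format, OF f(1,2)] dist_triangle2[of x s z] unfolding dist_norm by linarith
    then have "s \<in> cball x \<epsilon>" by simp
    with s Ex(1) show False by blast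
  qed
  then have "E x \<subseteq> {y. f y \<le> c}" by auto
  moreover have "convex {y. f y \<le> c}"
  proof -
    have "convex (blinfun_apply f -` {..c})"
      by (rule convex_linear_vimage[OF bounded_linear.linear[OF blinfun.bounded_linear_right]]) simp
    then show ?thesis by (simp add: vimage_def)
  qed
  moreover have "closed {y. f y \<le> c}" by (intro closed_Collect_le continuous_intros)
  ultimately have "closure (convex hull E x) \<subseteq> {y. f y \<le> c}"
    by (intro closure_minimal hull_minimal)
  with Ex(2) f(2) show False by auto
qed

section \<open>Scalars, sup norm and weak topology\<close>

lemma to_complex_one [simp]: "to_complex (1::'k::real_or_complex) = 1"
proof -
  have "to_complex (1::'k) \<noteq> 0" using norm_to_complex[of "1::'k"] by auto
  moreover have "to_complex (1::'k) * to_complex (1::'k) = to_complex (1::'k)"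
    using to_complex_mult[of "1::'k" 1] by simp
  ultimately show ?thesis by simp
qed

lemma to_complex_of_real [simp]: "to_complex (of_real r :: 'k::real_or_complex) = of_real r"
  using to_complex_scaleR[of r "1::'k"] by (simp add: of_real_def)

lemma to_complex_minus: "to_complex (- a) = - to_complex (a::'k::real_or_complex)"
  using to_complex_scaleR[of "-1" a] by simp

lemma to_complex_diff: "to_complex (a - b) = to_complex a - to_complex (b::'k::real_or_complex)"
  using to_complex_add[of a "- b"] by (simp add: to_complex_minus)

lemma dist_to_complex: "dist (to_complex a) (to_complex b) = dist a (b::'k::real_or_complex)"
  by (simp add: dist_norm norm_to_complex flip: to_complex_diff)

lemma to_complex_eq_iff: "to_complex a = to_complex b \<longleftrightarrow> a = (b::'k::real_or_complex)"
  using dist_to_complex[of a b] by (metis dist_eq_0_iff)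

lemma bounded_linear_to_complex: "bounded_linear (to_complex :: 'k::real_or_complex \<Rightarrow> complex)"
  by (rule bounded_linear_intro[where K = 1]) (auto simp: to_complex_add to_complex_scaleR norm_to_complex)

lemma re_le_norm: "\<bar>re a\<bar> \<le> norm (a::'k::real_or_complex)"
  using abs_Re_le_cmod[of "to_complex a"] by (simp add: re_def norm_to_complex)

lemma re_of_real [simp]: "re (of_real r :: 'k::real_or_complex) = r"
  by (simp add: re_def)

lemma continuous_on_re: "continuous_on A (re :: 'k::real_or_complex \<Rightarrow> real)"
  unfolding re_def by (intro continuous_intros bounded_linear.continuous_on[OF bounded_linear_to_complex])

lemma unimodular_rotation:
  fixes a :: "'k::real_normed_field"
  obtains \<omega> where "norm \<omega> = 1" "\<omega> * a = of_real (norm a)"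
proof (cases "a = 0")
  case True
  then show ?thesis using that[of 1] by simp
next
  case False
  then show ?thesis using that[of "of_real (norm a) / a"] by (simp add: norm_divide)
qed

lemma closed_range_to_complex: "closed (range (to_complex :: 'k::real_or_complex \<Rightarrow> complex))"
  using range_to_complex[where 'a = 'k] closed_complex_Reals by auto

text \<open>Compactness is pulled back from the complex plane: \<open>to_complex\<close> is an
  isometry with closed range, so its inverse is continuous on the part of the range in a closed
  disc.\<close>

lemma compact_cball_scalar: "compact (cball (0::'k::real_or_complex) r)"
proof -
  let ?C = "range (to_complex :: 'k \<Rightarrow> complex) \<inter> cball 0 r"
  let ?g = "inv (to_complex :: 'k \<Rightarrow> complex)"
  have inv: "?g (to_complex a) = a" for a :: 'k
    by (rule inv_f_f) (simp add: inj_def to_complex_eq_iff)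
  have "compact ?C" using closed_range_to_complex by (intro closed_Int_compact compact_cball)
  moreover have "continuous_on ?C ?g"
  proof (rule continuous_onI)
    fix u :: complex and e :: real
    assume u: "u \<in> ?C" "0 < e"
    have "dist (?g v) (?g u) = dist v u" if "v \<in> ?C" for v
    proof -
      obtain a b :: 'k where "u = to_complex a" "v = to_complex b" using u(1) \<open>v \<in> ?C\<close> by blast
      then show ?thesis by (simp only: inv dist_to_complex)
    qed
    with u(2) show "\<exists>d>0. \<forall>v\<in>?C. dist v u < d \<longrightarrow> dist (?g v) (?g u) \<le> e"
      by (intro exI[of _ e]) simp
  qed
  ultimately have "compact (?g ` ?C)" by (rule compact_continuous_image[rotated])
  also have "?g ` ?C = cball 0 r"
  proof (intro equalityI subsetI)
    fix a :: 'k assume "a \<in> cball 0 r"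
    then have "to_complex a \<in> ?C" by (simp add: norm_to_complex)
    then have "?g (to_complex a) \<in> ?g ` ?C" by (rule imageI)
    then show "a \<in> ?g ` ?C" by (simp only: inv)
  qed (auto simp: inv norm_to_complex)
  finally show ?thesis .
qed

lemma compact_sphere_scalar: "compact (sphere (0::'k::real_or_complex) r)"
proof -
  have "compact (cball (0::'k) r \<inter> sphere 0 r)"
    using closed_Collect_eq[of norm "\<lambda>_. r"]
    by (intro compact_Int_closed compact_cball_scalar) (simp add: sphere_def continuous_on_norm_id)
  also have "cball (0::'k) r \<inter> sphere 0 r = sphere 0 r" by auto
  finally show ?thesis .
qed

text \<open>Taking \<open>j = 0\<close> for real and \<open>j = \<i>\<close> for complex scalars allows both cases to share the formula
  \<open>F v = f v - j f (j v)\<close> recovering a functional from its real part.\<close>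

lemma imaginary_unit_or_zero:
  obtains j :: "'k::real_or_complex" where "j = 0 \<or> j * j = -1" "re j = 0"
    "\<And>a. \<exists>\<alpha> \<beta>. a = of_real \<alpha> + of_real \<beta> * j"
  using range_to_complex[where 'a = 'k]
proof
  assume R: "range (to_complex :: 'k \<Rightarrow> complex) = \<real>"
  show ?thesis
  proof (rule that[of 0])
    fix a :: 'k
    have "to_complex a \<in> \<real>" using R by blast
    then obtain r where "to_complex a = of_real r" by (auto elim: Reals_cases)
    then have "to_complex a = to_complex (of_real r :: 'k)" by simp
    then have "a = of_real r" by (simp only: to_complex_eq_iff)
    then have "a = of_real r + of_real 0 * 0" by simp
    then show "\<exists>\<alpha> \<beta>. a = of_real \<alpha> + of_real \<beta> * 0" by blast
  qed (use re_of_real[of 0, where 'k = 'k] in auto)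
next
  assume C: "range (to_complex :: 'k \<Rightarrow> complex) = UNIV"
  then obtain j :: 'k where j: "to_complex j = \<i>" by (metis surjD)
  show ?thesis
  proof (rule that[of j])
    have "to_complex (j * j) = to_complex (- 1 :: 'k)" by (simp add: to_complex_mult to_complex_minus j)
    then have "j * j = - 1" unfolding to_complex_eq_iff .
    then show "j = 0 \<or> j * j = - 1" ..
    show "re j = 0" by (simp add: re_def j)
    fix a :: 'k
    have "to_complex a = to_complex (of_real (Re (to_complex a)) + of_real (Im (to_complex a)) * j)"
      by (simp add: to_complex_add to_complex_mult j complex_eq_iff)
    then have "a = of_real (Re (to_complex a)) + of_real (Im (to_complex a)) * j"
      by (simp only: to_complex_eq_iff)
    then show "\<exists>\<alpha> \<beta>. a = of_real \<alpha> + of_real \<beta> * j" by blast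
  qed
qed

section \<open>Bounded maps on the ball and their sup norm\<close>

lemma norm_le_sup_norm:
  assumes "\<Psi> \<in> ell_infty"
  shows "norm (\<Psi> x) \<le> sup_norm \<Psi>"
proof -
  have "bounded ((\<lambda>x. norm (\<Psi> x)) ` cball 0 1)"
    using assms unfolding ell_infty_def bounded_iff by auto
  then have bdd: "bdd_above ((\<lambda>x. norm (\<Psi> x)) ` cball 0 1)" by (rule bounded_imp_bdd_above)
  have le: "norm (\<Psi> x) \<le> sup_norm \<Psi>" if "x \<in> cball 0 1" for x
    unfolding sup_norm_def using bdd that by (intro cSUP_upper)
  show ?thesis
  proof (cases "x \<in> cball 0 1")
    case False
    then have "\<Psi> x = 0" using assms by (simp add: ell_infty_def)
    then show ?thesis using order_trans[OF norm_ge_zero le[of 0]] by simp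
  qed (rule le)
qed

lemma sup_norm_nonneg: "\<Psi> \<in> ell_infty \<Longrightarrow> 0 \<le> sup_norm \<Psi>"
  using norm_le_sup_norm[of \<Psi> 0] norm_ge_zero[of "\<Psi> 0"] by linarith

lemma sup_norm_least:
  fixes \<Psi> :: "'x::real_normed_vector \<Rightarrow> 'v::real_normed_vector"
  assumes "\<And>x. x \<in> cball 0 1 \<Longrightarrow> norm (\<Psi> x) \<le> c"
  shows "sup_norm \<Psi> \<le> c"
  unfolding sup_norm_def using assms by (intro cSUP_least) auto

lemma less_sup_normD:
  fixes \<Psi> :: "'x::real_normed_vector \<Rightarrow> 'v::real_normed_vector"
  assumes "c < sup_norm \<Psi>"
  obtains x where "x \<in> cball 0 1" "c < norm (\<Psi> x)"
proof (rule ccontr)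
  assume "\<not> thesis"
  with that have "sup_norm \<Psi> \<le> c" by (intro sup_norm_least) force
  with assms show False by simp
qed

lemma ell_inftyI:
  assumes "\<And>x. x \<in> cball 0 1 \<Longrightarrow> norm (\<Psi> x) \<le> c" "\<And>x. x \<notin> cball 0 1 \<Longrightarrow> \<Psi> x = 0"
  shows "\<Psi> \<in> ell_infty"
proof -
  have "bounded (\<Psi> ` cball 0 1)" using assms(1) by (intro boundedI[of _ c]) auto
  with assms(2) show ?thesis by (simp add: ell_infty_def)
qed

lemma ell_infty_eq_zero: "\<Psi> \<in> ell_infty \<Longrightarrow> x \<notin> cball 0 1 \<Longrightarrow> \<Psi> x = 0"
  by (simp add: ell_infty_def)

text \<open>Only norms are compared, so \<open>g\<close> and \<open>h\<close> may have different
  codomains. This covers both scalar multiples of a function and the passage from \<open>x'\<close>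
  to \<open>tensor smul x' y\<close>.\<close>

lemma sup_norm_proportional:
  assumes h: "h \<in> ell_infty" and g: "\<And>x. norm (g x) = c * norm (h x)" and c: "c \<ge> 0"
  shows "g \<in> ell_infty" "sup_norm g = c * sup_norm h"
proof -
  have g_le: "norm (g x) \<le> c * sup_norm h" for x
    unfolding g using norm_le_sup_norm[OF h] c by (rule mult_left_mono)
  show ell: "g \<in> ell_infty"
  proof (rule ell_inftyI)
    show "norm (g x) \<le> c * sup_norm h" for x by (rule g_le)
    show "g x = 0" if "x \<notin> cball 0 1" for x
      using g[of x] ell_infty_eq_zero[OF h that] by simp
  qed
  show "sup_norm g = c * sup_norm h"
  proof (cases "c = 0")
    case True
    then show ?thesis using g_le sup_norm_nonneg[OF ell] sup_norm_least[of g 0] by simp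
  next
    case False
    have "sup_norm h \<le> sup_norm g / c"
    proof (rule sup_norm_least)
      fix x
      show "norm (h x) \<le> sup_norm g / c"
        using norm_le_sup_norm[OF ell, of x] False c unfolding g by (simp add: field_simps)
    qed
    then have "c * sup_norm h \<le> sup_norm g" using False c by (simp add: field_simps)
    moreover have "sup_norm g \<le> c * sup_norm h" by (rule sup_norm_least) (rule g_le)
    ultimately show ?thesis by simp
  qed
qed

lemma subspace_ell_infty_scale:
  fixes x' :: "'x::real_normed_vector \<Rightarrow> 'k::real_or_complex"
  assumes "linear_subspace_ell_infty Z" "x' \<in> Z"
  shows "fun_scale (*) a x' \<in> Z"
proof -
  have "vector_space ((*) :: 'k \<Rightarrow> 'k \<Rightarrow> 'k)" by unfold_locales (auto simp: algebra_simps)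
  then have "vector_space (fun_scale ((*) :: 'k \<Rightarrow> 'k \<Rightarrow> 'k) :: 'k \<Rightarrow> ('x \<Rightarrow> 'k) \<Rightarrow> _)"
    by (rule vector_space_fun_scale)
  then have "module (fun_scale ((*) :: 'k \<Rightarrow> 'k \<Rightarrow> 'k) :: 'k \<Rightarrow> ('x \<Rightarrow> 'k) \<Rightarrow> _)"
    by (simp add: module_iff_vector_space)
  from module.subspace_scale[OF this] show ?thesis
    using assms by (simp add: linear_subspace_ell_infty_def)
qed

section \<open>Scalar-linear functionals and the weak topology\<close>

context banach_space_over
begin

lemma scaleR_eq_smul: "scaleR r v = smul (of_real r) v"
  by (simp add: smul_of_real)

lemma bounded_linear_smul: "bounded_linear (smul a)"
proof (rule bounded_linear_intro[where K = "norm a"])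
  show "smul a (x + y) = smul a x + smul a y" for x y by (rule scale_right_distrib)
  show "smul a (r *\<^sub>R x) = r *\<^sub>R smul a x" for r x
    by (simp add: scaleR_eq_smul mult.commute)
  show "norm (smul a x) \<le> norm x * norm a" for x by (simp add: norm_smul)
qed

lemma dual_space_smul: "F \<in> dual_space smul \<Longrightarrow> F (smul a v) = a * F v"
  by (simp add: dual_space_def Vector_Spaces.linear_iff)

text \<open>Every scalar is a real combination of \<open>1\<close> and \<open>j\<close>, so
  homogeneity of \<open>F\<close> reduces to real factors and \<open>j\<close>. This carries the
  real separation results over to the weak topology, which is generated by scalar-linear
  functionals.\<close>

lemma real_functional_eq_re:
  fixes f :: "'v \<Rightarrow>\<^sub>L real"
  obtains F where "F \<in> dual_space smul" "\<And>v. re (F v) = f v"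
proof -
  obtain j :: 'k where j: "j = 0 \<or> j * j = -1" "re j = 0"
    and decomp: "\<And>a. \<exists>\<alpha> \<beta>. a = of_real \<alpha> + of_real \<beta> * j"
    using imaginary_unit_or_zero by blast
  define F where "F v = of_real (f v) - j * of_real (f (smul j v))" for v
  have add: "F (u + v) = F u + F v" for u v
    by (simp add: F_def scale_right_distrib blinfun.add_right algebra_simps)
  have real: "f (smul (of_real r) v) = r * f v" for r v
    by (simp add: smul_of_real blinfun.scaleR_right)
  have F_real: "F (smul (of_real r) v) = of_real r * F v" for r v
  proof -
    have "smul j (smul (of_real r) v) = smul (of_real r) (smul j v)" by (simp add: mult.commute)
    then show ?thesis unfolding F_def by (simp only: real) (simp add: algebra_simps)
  qed
  have F_j: "F (smul j v) = j * F v" for v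
    using j(1)
  proof
    assume "j * j = -1"
    then have "F (smul j v) = of_real (f (smul j v)) - j * of_real (f (smul (- 1) v))"
      by (simp add: F_def)
    also have "f (smul (- 1) v) = - f v" using real[of "-1" v] by simp
    also have "of_real (f (smul j v)) - j * of_real (- f v) = j * F v"
      using \<open>j * j = -1\<close> by (simp add: F_def right_diff_distrib flip: mult.assoc)
    finally show ?thesis .
  next
    assume j0: "j = 0"
    have "F 0 = 0" using add[of 0 0] by simp
    then show ?thesis using j0 by simp
  qed
  have scale: "F (smul a v) = a * F v" for a v
  proof -
    obtain \<alpha> \<beta> where a: "a = of_real \<alpha> + of_real \<beta> * j" using decomp by blast
    have "F (smul a v) = F (smul (of_real \<alpha>) v) + F (smul (of_real \<beta>) (smul j v))"
      unfolding a scale_left_distrib add by simp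
    then show ?thesis unfolding a F_real F_j by (simp add: algebra_simps)
  qed
  have "continuous_on UNIV F"
    unfolding F_def
    by (intro continuous_intros bounded_linear.continuous_on[OF bounded_linear_smul])
  moreover have "Vector_Spaces.linear smul (*) F"
    unfolding Vector_Spaces.linear_iff
  proof (intro conjI allI)
    show "vector_space smul" by (rule vector_space_axioms)
    show "vector_space ((*) :: 'k \<Rightarrow> 'k \<Rightarrow> 'k)" by unfold_locales (auto simp: algebra_simps)
  qed (use add scale in auto)
  moreover have "re (F v) = f v" for v
    using j(2) by (simp add: F_def re_def to_complex_diff to_complex_mult)
  ultimately show ?thesis using that by (simp add: dual_space_def)
qed

lemma topspace_weak_topology [simp]: "topspace (weak_topology smul) = UNIV"
proof -
  obtain F where "F \<in> dual_space smul" using real_functional_eq_re[of 0] by blast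
  then have "F -` UNIV \<in> {f -` U |f U. f \<in> dual_space smul \<and> open U}" by blast
  then show ?thesis by (auto simp: weak_topology_def)
qed

lemma continuous_map_dual:
  assumes F: "F \<in> dual_space smul"
  shows "continuous_map (weak_topology smul) euclidean F"
  unfolding continuous_map
proof (intro conjI allI impI)
  fix U :: "'k set" assume "openin euclidean U"
  then have "F -` U \<in> {f -` U |f U. f \<in> dual_space smul \<and> open U}" using F by auto
  then have "openin (weak_topology smul) (F -` U)"
    unfolding weak_topology_def by (rule topology_generated_by_Basis)
  then show "openin (weak_topology smul) {x \<in> topspace (weak_topology smul). F x \<in> U}"
    by (simp add: vimage_def)
qed simp

lemma continuous_map_real_functional:
  fixes f :: "'v \<Rightarrow>\<^sub>L real"
  shows "continuous_map (weak_topology smul) euclideanreal f"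
proof -
  obtain F where F: "F \<in> dual_space smul" "\<And>v. re (F v) = f v" using real_functional_eq_re by blast
  have "continuous_map (weak_topology smul) euclideanreal (re \<circ> F)"
    using continuous_map_dual[OF F(1)]
    by (rule continuous_map_compose) (simp add: continuous_on_re)
  also have "re \<circ> F = blinfun_apply f" using F(2) by (simp add: fun_eq_iff)
  finally show ?thesis .
qed

lemma continuous_map_into_weak:
  assumes cont: "\<And>F. F \<in> dual_space smul \<Longrightarrow> continuous_map X euclidean (F \<circ> g)"
  shows "continuous_map X (weak_topology smul) g"
  unfolding weak_topology_def
proof (rule continuous_on_generated_topo)
  fix V assume "V \<in> {f -` U |f U. f \<in> dual_space smul \<and> open U}"
  then obtain F U where FU: "V = F -` U" "F \<in> dual_space smul" "open U" by blast
  have "openin X {x \<in> topspace X. (F \<circ> g) x \<in> U}"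
    by (rule openin_continuous_map_preimage[OF cont[OF FU(2)]]) (simp add: FU)
  also have "{x \<in> topspace X. (F \<circ> g) x \<in> U} = g -` V \<inter> topspace X" by (auto simp: FU)
  finally show "openin X (g -` V \<inter> topspace X)" .
next
  show "g ` topspace X \<subseteq> \<Union>{f -` U |f U. f \<in> dual_space smul \<and> open U}"
    using topspace_weak_topology unfolding weak_topology_def by simp
qed

text \<open>A functional norming \<open>x - y\<close> has different values at \<open>x\<close> and
  \<open>y\<close>. The property is used to make weakly compact sets weakly closed.\<close>

lemma Hausdorff_weak_topology: "Hausdorff_space (weak_topology smul)"
  unfolding Hausdorff_space_def
proof (intro allI impI)
  fix x y :: 'v
  assume xy: "x \<in> topspace (weak_topology smul) \<and> y \<in> topspace (weak_topology smul) \<and> x \<noteq> y"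
  obtain f :: "'v \<Rightarrow>\<^sub>L real" where "f (x - y) = norm (x - y)" using norming_functional by blast
  moreover have "0 < norm (x - y)" using xy by simp
  ultimately have fxy: "f y < f x" unfolding blinfun.diff_right by linarith
  define c where "c = (f x + f y) / 2"
  have c: "f y < c" "c < f x" using fxy by (simp_all add: c_def)
  have "openin (weak_topology smul) {v \<in> topspace (weak_topology smul). f v \<in> {c<..}}"
    "openin (weak_topology smul) {v \<in> topspace (weak_topology smul). f v \<in> {..<c}}"
    by (rule openin_continuous_map_preimage[OF continuous_map_real_functional], simp)+
  moreover have "disjnt {v \<in> topspace (weak_topology smul). f v \<in> {c<..}}
      {v \<in> topspace (weak_topology smul). f v \<in> {..<c}}"
    by (auto simp: disjnt_def)
  ultimately show "\<exists>U V. openin (weak_topology smul) U \<and> openin (weak_topology smul) V \<and>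
      x \<in> U \<and> y \<in> V \<and> disjnt U V"
    using c by (intro exI conjI) auto
qed

text \<open>Composed with a dual functional the map becomes a product of scalars. Joint continuity
  is what keeps a weakly compact set weakly compact after rotation by the whole unit sphere.\<close>

lemma continuous_map_smul_weak:
  "continuous_map (prod_topology euclidean (weak_topology smul)) (weak_topology smul) (\<lambda>(a, v). smul a v)"
proof (rule continuous_map_into_weak)
  fix F assume F: "F \<in> dual_space smul"
  let ?X = "prod_topology (euclidean :: 'k topology) (weak_topology smul)"
  have "continuous_map ?X euclidean (F \<circ> snd)"
    using continuous_map_snd continuous_map_dual[OF F] by (rule continuous_map_compose)
  then have "continuous_map ?X (prod_topology euclidean euclidean) (\<lambda>p. (fst p, (F \<circ> snd) p))"
    by (intro continuous_map_pairedI continuous_map_fst)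
  then have "continuous_map ?X euclidean ((\<lambda>(a, b). a * b) \<circ> (\<lambda>p. (fst p, (F \<circ> snd) p)))"
    by (rule continuous_map_compose)
      (auto simp: euclidean_product_topology case_prod_unfold intro!: continuous_intros)
  also have "(\<lambda>(a, b). a * b) \<circ> (\<lambda>p. (fst p, (F \<circ> snd) p)) = F \<circ> (\<lambda>(a, v). smul a v)"
    by (auto simp: fun_eq_iff dual_space_smul[OF F])
  finally show "continuous_map ?X euclidean (F \<circ> (\<lambda>(a, v). smul a v))" .
qed

text \<open>The range lies in the image of a compact scalar disc under
  \<open>a \<mapsto> smul a v\<close>; this image is weakly compact, hence weakly closed, and so
  contains the weak closure of the range.\<close>

lemma weakly_compact_tensor:
  assumes x': "x' \<in> ell_infty"
  shows "weakly_compact_map smul (tensor smul x' v)"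
proof -
  let ?W = "weak_topology smul" and ?K = "(\<lambda>a. smul a v) ` cball 0 (sup_norm x')"
  have "continuous_map euclidean ?W (\<lambda>a. smul a v)"
  proof (rule continuous_map_into_weak)
    fix F assume F: "F \<in> dual_space smul"
    have "F \<circ> (\<lambda>a. smul a v) = (\<lambda>a. a * F v)" by (simp add: fun_eq_iff dual_space_smul[OF F])
    then show "continuous_map euclidean euclidean (F \<circ> (\<lambda>a. smul a v))"
      by (simp add: continuous_intros)
  qed
  then have K: "compactin ?W ?K"
    by (rule image_compactin[rotated]) (simp add: compact_cball_scalar)
  have "tensor smul x' v ` cball 0 1 \<subseteq> ?K"
    using norm_le_sup_norm[OF x'] by (auto simp: tensor_def)
  then have "?W closure_of (tensor smul x' v ` cball 0 1) \<subseteq> ?K"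
    using compactin_imp_closedin[OF Hausdorff_weak_topology K] by (rule closure_of_minimal)
  then show ?thesis
    unfolding weakly_compact_map_def by (rule closed_compactin[OF K]) simp
qed

text \<open>The triangle inequality makes the sum an upper bound, and the norm of the perturbed map
  is Lipschitz in \<open>\<omega>\<close> with constant \<open>sup_norm \<Psi>\<close>. A maximiser
  therefore exists on the compact unit sphere, and approximate equality at single points
  suffices.\<close>

lemma is_maximum_iff:
  fixes \<Phi> \<Psi> :: "'x::real_normed_vector \<Rightarrow> 'v"
  assumes \<Phi>: "\<Phi> \<in> ell_infty" and \<Psi>: "\<Psi> \<in> ell_infty"
  shows "is_maximum {sup_norm (\<Phi> + fun_scale smul \<omega> \<Psi>) | \<omega>. norm \<omega> = 1} (sup_norm \<Phi> + sup_norm \<Psi>) \<longleftrightarrow>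
    (\<forall>\<epsilon>>0. \<exists>\<omega>. norm \<omega> = 1 \<and>
      (\<exists>x\<in>cball 0 1. sup_norm \<Phi> + sup_norm \<Psi> - \<epsilon> \<le> norm (\<Phi> x + smul \<omega> (\<Psi> x))))"
    (is "is_maximum ?A ?m \<longleftrightarrow> ?R")
proof -
  define g where "g \<omega> = \<Phi> + fun_scale smul \<omega> \<Psi>" for \<omega>
  have g: "g \<omega> x = \<Phi> x + smul \<omega> (\<Psi> x)" for \<omega> x by (simp add: g_def fun_scale_def)
  have ell: "g \<omega> \<in> ell_infty" for \<omega>
  proof (rule ell_inftyI)
    show "norm (g \<omega> x) \<le> sup_norm \<Phi> + norm \<omega> * sup_norm \<Psi>" for x
      unfolding g
      by (intro norm_triangle_le add_mono norm_le_sup_norm[OF \<Phi>])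
        (simp add: norm_smul mult_left_mono norm_le_sup_norm[OF \<Psi>])
    show "g \<omega> x = 0" if "x \<notin> cball 0 1" for x
      using ell_infty_eq_zero[OF \<Phi> that] ell_infty_eq_zero[OF \<Psi> that] by (simp add: g)
  qed
  have upper: "sup_norm (g \<omega>) \<le> ?m" if "norm \<omega> = 1" for \<omega>
  proof (rule sup_norm_least)
    show "norm (g \<omega> x) \<le> ?m" for x
      unfolding g
      by (intro norm_triangle_le add_mono norm_le_sup_norm[OF \<Phi>])
        (simp add: norm_smul that norm_le_sup_norm[OF \<Psi>])
  qed
  have lip: "sup_norm (g \<omega>) \<le> sup_norm (g \<omega>') + dist \<omega> \<omega>' * sup_norm \<Psi>" for \<omega> \<omega>'
  proof (rule sup_norm_least)
    fix x
    have "g \<omega> x = g \<omega>' x + smul (\<omega> - \<omega>') (\<Psi> x)" by (simp add: g scale_left_diff_distrib)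
    moreover have "norm (smul (\<omega> - \<omega>') (\<Psi> x)) \<le> dist \<omega> \<omega>' * sup_norm \<Psi>"
      by (simp add: norm_smul dist_norm mult_left_mono norm_le_sup_norm[OF \<Psi>])
    ultimately show "norm (g \<omega> x) \<le> sup_norm (g \<omega>') + dist \<omega> \<omega>' * sup_norm \<Psi>"
      using norm_triangle_le[OF add_mono[OF norm_le_sup_norm[OF ell]]] by simp
  qed
  have "(sup_norm \<Psi>)-lipschitz_on (sphere 0 1) (\<lambda>\<omega>. sup_norm (g \<omega>))"
  proof (rule lipschitz_onI)
    show "dist (sup_norm (g \<omega>)) (sup_norm (g \<omega>')) \<le> sup_norm \<Psi> * dist \<omega> \<omega>'" for \<omega> \<omega>'
      using lip[of \<omega> \<omega>'] lip[of \<omega>' \<omega>] by (simp add: dist_real_def dist_commute mult.commute abs_le_iff)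
  qed (rule sup_norm_nonneg[OF \<Psi>])
  then have cont: "continuous_on (sphere 0 1) (\<lambda>\<omega>. sup_norm (g \<omega>))"
    by (rule lipschitz_on_continuous_on)
  have "(1 :: 'k) \<in> sphere 0 1" by simp
  then have "sphere (0::'k) 1 \<noteq> {}" by blast
  from continuous_attains_sup[OF compact_sphere_scalar this cont]
  obtain \<omega>' where \<omega>': "norm \<omega>' = 1" "\<And>\<omega>. norm \<omega> = 1 \<Longrightarrow> sup_norm (g \<omega>) \<le> sup_norm (g \<omega>')"
    by auto
  have "is_maximum ?A ?m \<longleftrightarrow> (\<exists>\<omega>. norm \<omega> = 1 \<and> sup_norm (g \<omega>) = ?m)"
  proof -
    have "is_maximum ?A ?m \<longleftrightarrow> ?m \<in> ?A"
      using upper unfolding is_maximum_def g_def[symmetric] by blast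
    also have "\<dots> \<longleftrightarrow> (\<exists>\<omega>. norm \<omega> = 1 \<and> sup_norm (g \<omega>) = ?m)"
      unfolding g_def[symmetric] mem_Collect_eq by metis
    finally show ?thesis .
  qed
  also have "\<dots> \<longleftrightarrow> ?R"
  proof
    assume "\<exists>\<omega>. norm \<omega> = 1 \<and> sup_norm (g \<omega>) = ?m"
    then obtain \<omega> where \<omega>: "norm \<omega> = 1" "sup_norm (g \<omega>) = ?m" by blast
    show ?R
    proof (intro allI impI)
      fix \<epsilon> :: real assume "\<epsilon> > 0"
      then have "?m - \<epsilon> < sup_norm (g \<omega>)" using \<omega>(2) by simp
      then obtain x where "x \<in> cball 0 1" "?m - \<epsilon> < norm (g \<omega> x)" by (rule less_sup_normD)
      with \<omega>(1) show "\<exists>\<omega>. norm \<omega> = 1 \<and> (\<exists>x\<in>cball 0 1. ?m - \<epsilon> \<le> norm (\<Phi> x + smul \<omega> (\<Psi> x)))"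
        unfolding g by (intro exI[of _ \<omega>] conjI bexI[of _ x]) simp_all
    qed
  next
    assume R: ?R
    have "?m \<le> sup_norm (g \<omega>')"
    proof (rule field_le_epsilon)
      fix \<epsilon> :: real assume "\<epsilon> > 0"
      with R obtain \<omega> x where \<omega>: "norm \<omega> = 1" "?m - \<epsilon> \<le> norm (g \<omega> x)" unfolding g by blast
      then show "?m \<le> sup_norm (g \<omega>') + \<epsilon>"
        using norm_le_sup_norm[OF ell, of \<omega> x] \<omega>'(2)[OF \<omega>(1)] by linarith
    qed
    with upper[OF \<omega>'(1)] \<omega>'(1) show "\<exists>\<omega>. norm \<omega> = 1 \<and> sup_norm (g \<omega>) = ?m"
      by (intro exI[of _ \<omega>'] conjI) simp_all
  qed
  finally show ?thesis .
qed

end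

section \<open>The alternative Daugavet equation\<close>

text \<open>Near-additivity of norms passes from \<open>y\<close> to its nonnegative multiples. For
  \<open>l \<le> 1\<close> the vector \<open>(1 - l) *\<^sub>R y\<close> is removed from
  \<open>u + y\<close>; for \<open>l > 1\<close> the vector \<open>(l - 1) *\<^sub>R u\<close> is
  removed from \<open>l *\<^sub>R (u + y)\<close>. The stated bound covers both losses.\<close>

lemma norm_add_scaleR_ge:
  fixes u y :: "'v::real_normed_vector"
  assumes u: "norm u \<le> 1" and y: "norm y = 1" and uy: "2 - e \<le> norm (u + y)" and l: "0 \<le> l"
  shows "(1 + l) * (1 - e) \<le> norm (u + l *\<^sub>R y)"
proof -
  have "norm (u + y) \<le> 1 + 1" using u y by (intro norm_triangle_le) simp
  then have e: "0 \<le> e" using uy by linarith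
  show ?thesis
  proof (cases "l \<le> 1")
    case True
    have "norm (u + y) \<le> norm (u + l *\<^sub>R y) + norm ((1 - l) *\<^sub>R y)"
      using norm_triangle_ineq[of "u + l *\<^sub>R y" "(1 - l) *\<^sub>R y"] by (simp add: scaleR_diff_left)
    moreover have "norm ((1 - l) *\<^sub>R y) = 1 - l" using True y by simp
    moreover have "0 \<le> l * e" using l e by simp
    ultimately show ?thesis using uy by (simp add: algebra_simps)
  next
    case False
    have "norm (l *\<^sub>R (u + y)) \<le> norm (u + l *\<^sub>R y) + norm ((l - 1) *\<^sub>R u)"
      using norm_triangle_ineq[of "u + l *\<^sub>R y" "(l - 1) *\<^sub>R u"]
      by (simp add: scaleR_diff_left scaleR_add_right algebra_simps)
    moreover have "norm ((l - 1) *\<^sub>R u) \<le> l - 1"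
      using mult_left_mono[OF u, of "l - 1"] False by simp
    moreover have "l * (2 - e) \<le> norm (l *\<^sub>R (u + y))"
      using mult_left_mono[OF uy l] l by simp
    ultimately show ?thesis using e by (simp add: algebra_simps)
  qed
qed

context banach_space_over
begin

text \<open>The slice is cut from the set of all rotations of values of \<open>\<Psi>\<close>. Its
  smallness is stated for every \<open>\<theta>\<close> because (3) controls only the modulus of
  \<open>F (\<Psi> x)\<close>, and the rotation making this value real is chosen after
  \<open>x\<close>.\<close>

lemma weakly_compact_map_slice:
  fixes \<Psi> :: "'x::real_normed_vector \<Rightarrow> 'v"
  assumes \<Psi>: "\<Psi> \<in> ell_infty" and wc: "weakly_compact_map smul \<Psi>"
    and m: "0 \<le> m" "m < sup_norm \<Psi>" and \<eta>: "\<eta> > 0"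
  obtains F c \<omega> z where "F \<in> dual_space smul" "norm \<omega> = 1" "z \<in> cball 0 1" "m < norm (\<Psi> z)"
    "c < re (\<omega> * F (\<Psi> z))"
    "\<forall>\<theta> x. norm \<theta> = 1 \<and> x \<in> cball 0 1 \<and> c < re (\<theta> * F (\<Psi> x)) \<longrightarrow>
      norm (smul \<theta> (\<Psi> x) - smul \<omega> (\<Psi> z)) \<le> \<eta>"
proof -
  let ?W = "weak_topology smul"
  let ?K = "?W closure_of (\<Psi> ` cball 0 1)"
  let ?h = "\<lambda>(a, v). smul a v"
  define S where "S = {smul \<theta> (\<Psi> x) |\<theta> x. norm \<theta> = 1 \<and> x \<in> cball 0 1}"
  have S_I: "smul \<theta> (\<Psi> x) \<in> S" if "norm \<theta> = 1" "x \<in> cball 0 1" for \<theta> x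
    unfolding S_def using that by blast
  have "compactin (prod_topology euclidean ?W) (sphere (0::'k) 1 \<times> ?K)"
    using wc by (simp add: compactin_Times compact_sphere_scalar weakly_compact_map_def)
  then have K: "compactin ?W (?h ` (sphere 0 1 \<times> ?K))"
    using continuous_map_smul_weak by (rule image_compactin)
  have "\<Psi> ` cball 0 1 \<subseteq> ?K" by (rule closure_of_subset) simp
  then have SK: "S \<subseteq> ?h ` (sphere 0 1 \<times> ?K)" unfolding S_def by force
  have S: "bounded S"
  proof (rule boundedI)
    fix s assume "s \<in> S"
    then obtain \<theta> x where "norm \<theta> = 1" "s = smul \<theta> (\<Psi> x)" unfolding S_def by blast
    then show "norm s \<le> sup_norm \<Psi>" using norm_le_sup_norm[OF \<Psi>, of x] by (simp add: norm_smul)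
  qed
  obtain x0 where x0: "x0 \<in> cball 0 1" "m < norm (\<Psi> x0)" using m(2) by (rule less_sup_normD)
  have x0S: "\<Psi> x0 \<in> S" using S_I[of 1 x0] x0(1) by simp
  obtain f :: "'v \<Rightarrow>\<^sub>L real" and c s where s: "s \<in> S" "m < norm s" "c < f s"
    and slice: "\<forall>t\<in>S. c < f t \<longrightarrow> norm (t - s) \<le> \<eta>"
    using continuous_map_real_functional K SK S x0S m(1) x0(2) \<eta> by (rule small_slice)
  obtain F where F: "F \<in> dual_space smul" "\<And>v. re (F v) = f v"
    using real_functional_eq_re[of f] by blast
  obtain \<omega> z where \<omega>: "norm \<omega> = 1" "z \<in> cball 0 1" "s = smul \<omega> (\<Psi> z)"
    using s(1) unfolding S_def by blast
  have f: "f (smul \<theta> v) = re (\<theta> * F v)" for \<theta> v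
    using F(2)[of "smul \<theta> v"] by (simp add: dual_space_smul[OF F(1)])
  show ?thesis
  proof (rule that[OF F(1) \<omega>(1,2)])
    show "m < norm (\<Psi> z)" using s(2) \<omega> by (simp add: norm_smul)
    show "c < re (\<omega> * F (\<Psi> z))" using s(3) unfolding \<omega>(3) f .
    show "\<forall>\<theta> x. norm \<theta> = 1 \<and> x \<in> cball 0 1 \<and> c < re (\<theta> * F (\<Psi> x)) \<longrightarrow>
      norm (smul \<theta> (\<Psi> x) - smul \<omega> (\<Psi> z)) \<le> \<eta>"
    proof (intro allI impI)
      fix \<theta> x assume x: "norm \<theta> = 1 \<and> x \<in> cball 0 1 \<and> c < re (\<theta> * F (\<Psi> x))"
      then have "smul \<theta> (\<Psi> x) \<in> S" by (intro S_I) simp_all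
      with slice x f show "norm (smul \<theta> (\<Psi> x) - smul \<omega> (\<Psi> z)) \<le> \<eta>"
        unfolding \<omega>(3) by metis
    qed
  qed
qed

lemma weakly_compact_alternative_Daugavet:
  fixes \<Phi> \<Psi> :: "'x::real_normed_vector \<Rightarrow> 'v" and Z :: "('x \<Rightarrow> 'k) set"
  assumes Z: "linear_subspace_ell_infty Z" and \<Phi>: "\<Phi> \<in> ell_infty" "sup_norm \<Phi> = 1"
    and P3: "\<And>x' y \<epsilon>. x' \<in> Z \<Longrightarrow> sup_norm x' = 1 \<Longrightarrow> norm y = 1 \<Longrightarrow> \<epsilon> > 0 \<Longrightarrow>
      \<exists>\<omega>. norm \<omega> = 1 \<and> (\<exists>x\<in>cball 0 1. norm (x' x) \<ge> 1 - \<epsilon> \<and> norm (smul \<omega> (\<Phi> x) + y) \<ge> 2 - \<epsilon>)"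
    and \<Psi>: "\<Psi> \<in> ell_infty" "weakly_compact_map smul \<Psi>"
    and \<Psi>Z: "\<And>F. F \<in> dual_space smul \<Longrightarrow> F \<circ> \<Psi> \<in> Z"
  shows "is_maximum {sup_norm (\<Phi> + fun_scale smul \<omega> \<Psi>) | \<omega>. norm \<omega> = 1} (sup_norm \<Phi> + sup_norm \<Psi>)"
  unfolding is_maximum_iff[OF \<Phi>(1) \<Psi>(1)] unfolding \<Phi>(2)
proof (intro allI impI)
  fix \<epsilon> :: real assume \<epsilon>: "\<epsilon> > 0"
  define M where "M = sup_norm \<Psi>"
  have M: "norm (\<Psi> x) \<le> M" for x unfolding M_def by (rule norm_le_sup_norm[OF \<Psi>(1)])
  show "\<exists>\<omega>. norm \<omega> = 1 \<and> (\<exists>x\<in>cball 0 1. 1 + sup_norm \<Psi> - \<epsilon> \<le> norm (\<Phi> x + smul \<omega> (\<Psi> x)))"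
    unfolding M_def[symmetric]
  proof (cases "M = 0")
    case True
    \<comment> \<open>For \<open>\<Psi> = 0\<close> there is no vector \<open>s\<close> to
      normalise, but a near-maximal value of \<open>\<Phi>\<close> is all that is required.\<close>
    have "1 - \<epsilon> < sup_norm \<Phi>" using \<epsilon> \<Phi>(2) by simp
    then obtain x where "x \<in> cball 0 1" "1 - \<epsilon> < norm (\<Phi> x)" by (rule less_sup_normD)
    moreover have "\<Psi> x = 0" using M[of x] True by simp
    ultimately show "\<exists>\<omega>. norm \<omega> = 1 \<and> (\<exists>x\<in>cball 0 1. 1 + M - \<epsilon> \<le> norm (\<Phi> x + smul \<omega> (\<Psi> x)))"
      using True by (intro exI[of _ 1] conjI bexI[of _ x]) simp_all
  next
    case False
    then have M0: "M > 0" using sup_norm_nonneg[OF \<Psi>(1)] by (simp add: M_def)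
    \<comment> \<open>\<open>\<epsilon> / 4\<close> belongs to the final error budget;
      \<open>M / 4\<close> keeps \<open>M - \<eta>\<close> nonnegative and makes
      \<open>2 * norm s\<close> exceed \<open>\<eta>\<close>.\<close>
    define \<eta> where "\<eta> = min (\<epsilon> / 4) (M / 4)"
    have \<eta>: "\<eta> > 0" "\<eta> \<le> \<epsilon> / 4" "\<eta> \<le> M / 4" using \<epsilon> M0 by (simp_all add: \<eta>_def)
    have m: "0 \<le> M - \<eta>" "M - \<eta> < sup_norm \<Psi>" using \<eta> M0 by (simp_all add: M_def)
    obtain F c \<omega>\<^sub>0 z where F: "F \<in> dual_space smul" and \<omega>\<^sub>0: "norm \<omega>\<^sub>0 = 1"
      and z: "z \<in> cball 0 1" "M - \<eta> < norm (\<Psi> z)" "c < re (\<omega>\<^sub>0 * F (\<Psi> z))"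
      and slice: "\<forall>\<theta> x. norm \<theta> = 1 \<and> x \<in> cball 0 1 \<and> c < re (\<theta> * F (\<Psi> x)) \<longrightarrow>
        norm (smul \<theta> (\<Psi> x) - smul \<omega>\<^sub>0 (\<Psi> z)) \<le> \<eta>"
      using \<Psi> m \<eta>(1) by (rule weakly_compact_map_slice)
    define s where "s = smul \<omega>\<^sub>0 (\<Psi> z)"
    have norm_s: "norm s = norm (\<Psi> z)" by (simp add: s_def norm_smul \<omega>\<^sub>0)
    have FZ: "F \<circ> \<Psi> \<in> Z" using F by (rule \<Psi>Z)
    then have F\<Psi>: "F \<circ> \<Psi> \<in> ell_infty" using Z by (auto simp: linear_subspace_ell_infty_def)
    define p where "p = sup_norm (F \<circ> \<Psi>)"
    have p: "norm (F (\<Psi> x)) \<le> p" for x using norm_le_sup_norm[OF F\<Psi>, of x] by (simp add: p_def)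
    have "re (\<omega>\<^sub>0 * F (\<Psi> z)) \<le> norm (\<omega>\<^sub>0 * F (\<Psi> z))" using re_le_norm abs_le_D1 by blast
    also have "\<dots> \<le> p" using p[of z] by (simp add: norm_mult \<omega>\<^sub>0)
    finally have cp: "c < p" using z(3) by simp
    \<comment> \<open>If \<open>F\<close> vanished on the range of \<open>\<Psi>\<close>, the slice
      would contain \<open>- s\<close> along with \<open>s\<close> and would be too wide.\<close>
    have p0: "p > 0"
    proof (rule ccontr)
      assume "\<not> p > 0"
      then have F0: "F (\<Psi> z) = 0" using order_trans[OF p[of z], of 0] by simp
      have "norm (smul (- \<omega>\<^sub>0) (\<Psi> z) - smul \<omega>\<^sub>0 (\<Psi> z)) \<le> \<eta>"
        using slice[rule_format, of "- \<omega>\<^sub>0" z] \<omega>\<^sub>0 z by (simp add: F0)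
      also have "smul (- \<omega>\<^sub>0) (\<Psi> z) - smul \<omega>\<^sub>0 (\<Psi> z) = - (2 *\<^sub>R s)"
        by (simp add: s_def scaleR_2)
      finally have "2 * norm s \<le> \<eta>" by simp
      with norm_s z(2) \<eta>(3) M0 show False by linarith
    qed
    define x' where "x' = fun_scale (*) (of_real (1 / p)) (F \<circ> \<Psi>)"
    have norm_x': "norm (x' x) = (1 / p) * norm ((F \<circ> \<Psi>) x)" for x
      using p0 by (simp add: x'_def fun_scale_def norm_mult norm_divide)
    have "x' \<in> Z" unfolding x'_def using Z FZ by (rule subspace_ell_infty_scale)
    moreover have "sup_norm x' = 1"
      using sup_norm_proportional(2)[OF F\<Psi> norm_x'] p0 unfolding p_def[symmetric] by simp
    moreover have ns: "norm s > 0" using norm_s z(2) m(1) by linarith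
    then have "norm ((1 / norm s) *\<^sub>R s) = 1" by simp
    \<comment> \<open>The first entry gives \<open>(1 - e) * p > c\<close>, so a rotation of
      \<open>\<Psi> x\<close> falls into the slice; the second gives
      \<open>(1 + norm s) * e \<le> \<epsilon> / 4\<close>.\<close>
    moreover define e where "e = min ((p - c) / (2 * p)) (\<epsilon> / (4 * (1 + M)))"
    have "e > 0" using cp p0 \<epsilon> M0 by (simp add: e_def)
    ultimately obtain \<omega> x where \<omega>: "norm \<omega> = 1" and x: "x \<in> cball 0 1"
      "1 - e \<le> norm (x' x)" "2 - e \<le> norm (smul \<omega> (\<Phi> x) + (1 / norm s) *\<^sub>R s)"
      using P3 by blast
    have "e \<le> (p - c) / (2 * p)" by (simp add: e_def)
    then have "2 * (e * p) \<le> p - c" using p0 by (simp add: field_simps)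
    moreover have "(1 - e) * p \<le> norm (F (\<Psi> x))" using x(2) p0 by (simp add: norm_x' field_simps)
    ultimately have cF: "c < norm (F (\<Psi> x))" using cp by (simp add: left_diff_distrib)
    obtain \<theta> where \<theta>: "norm \<theta> = 1" "\<theta> * F (\<Psi> x) = of_real (norm (F (\<Psi> x)))"
      using unimodular_rotation by blast
    have close: "norm (smul \<theta> (\<Psi> x) - s) \<le> \<eta>"
      unfolding s_def using slice[rule_format, of \<theta> x] \<theta> x(1) cF by simp
    let ?u = "smul \<omega> (\<Phi> x)"
    have "norm ?u \<le> 1" using norm_le_sup_norm[OF \<Phi>(1), of x] \<Phi>(2) \<omega> by (simp add: norm_smul)
    from norm_add_scaleR_ge[OF this _ x(3), of "norm s"]
    have "(1 + norm s) * (1 - e) \<le> norm (?u + s)" using ns by simp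
    moreover have "(1 + norm s) * e \<le> \<epsilon> / 4"
    proof -
      have "(1 + norm s) * e \<le> (1 + M) * (\<epsilon> / (4 * (1 + M)))"
        using M[of z] norm_s M0 \<open>e > 0\<close> by (intro mult_mono) (simp_all add: e_def)
      also have "\<dots> = \<epsilon> / 4" using M0 by (simp add: field_simps)
      finally show ?thesis .
    qed
    ultimately have "1 + norm s - \<epsilon> / 4 \<le> norm (?u + s)" by (simp add: algebra_simps)
    moreover have "norm (?u + s) \<le> norm (?u + smul \<theta> (\<Psi> x)) + norm (smul \<theta> (\<Psi> x) - s)"
      using norm_triangle_ineq4[of "?u + smul \<theta> (\<Psi> x)" "smul \<theta> (\<Psi> x) - s"] by simp
    \<comment> \<open>Three losses of at most \<open>\<epsilon> / 4\<close> each: from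
      \<open>e\<close>, from the distance of the rotated \<open>\<Psi> x\<close> to
      \<open>s\<close>, and from \<open>norm s > M - \<eta>\<close>.\<close>
    ultimately have "1 + M - \<epsilon> \<le> norm (?u + smul \<theta> (\<Psi> x))"
      using close norm_s z(2) \<eta>(2) \<epsilon> by linarith
    \<comment> \<open>Dividing by the rotation of \<open>\<Phi> x\<close> leaves
      \<open>\<Phi>\<close> untouched and produces the single scalar
      \<open>\<theta> / \<omega>\<close>.\<close>
    also have "?u + smul \<theta> (\<Psi> x) = smul \<omega> (\<Phi> x + smul (\<theta> / \<omega>) (\<Psi> x))"
      using \<omega> by (auto simp: scale_right_distrib)
    also have "norm \<dots> = norm (\<Phi> x + smul (\<theta> / \<omega>) (\<Psi> x))" using \<omega> by (simp add: norm_smul)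
    finally show "\<exists>\<omega>. norm \<omega> = 1 \<and> (\<exists>x\<in>cball 0 1. 1 + M - \<epsilon> \<le> norm (\<Phi> x + smul \<omega> (\<Psi> x)))"
      using \<omega> \<theta>(1) x(1)
      by (intro exI[of _ "\<theta> / \<omega>"] conjI bexI[of _ x]) (simp_all add: norm_divide)
  qed
qed

section \<open>Rank-one maps\<close>

lemma tensor_ell_infty:
  assumes "x' \<in> ell_infty"
  shows "tensor smul x' y \<in> ell_infty" "sup_norm (tensor smul x' y) = norm y * sup_norm x'"
proof -
  have "norm (tensor smul x' y x) = norm y * norm (x' x)" for x
    by (simp add: tensor_def norm_smul)
  from sup_norm_proportional[OF assms this]
  show "tensor smul x' y \<in> ell_infty" "sup_norm (tensor smul x' y) = norm y * sup_norm x'" by simp_all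
qed

text \<open>Supplies the membership hypothesis of (4) for rank-one maps: a subspace containing
  \<open>x'\<close> contains its scalar multiples.\<close>

lemma dual_comp_tensor: "F \<in> dual_space smul \<Longrightarrow> F \<circ> tensor smul x' y = fun_scale (*) (F y) x'"
  by (simp add: fun_eq_iff tensor_def fun_scale_def dual_space_smul)

text \<open>A sum of norms close to 2 with both summands at most 1 forces each to be close to 1.
  After a rotation the coefficient of \<open>y\<close> is the real number
  \<open>norm (x' x)\<close>; replacing it by 1 costs as much again, hence the choice
  \<open>e = \<epsilon> / 2\<close>.\<close>

lemma rank_one_imp_approximate:
  fixes \<Phi> :: "'x::real_normed_vector \<Rightarrow> 'v"
  assumes \<Phi>: "\<Phi> \<in> ell_infty" "sup_norm \<Phi> = 1"
    and x': "x' \<in> ell_infty" "sup_norm x' = 1" and y: "norm y = 1" and \<epsilon>: "\<epsilon> > 0"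
    and max: "is_maximum {sup_norm (\<Phi> + fun_scale smul \<omega> (tensor smul x' y)) | \<omega>. norm \<omega> = 1}
      (sup_norm \<Phi> + sup_norm (tensor smul x' y))"
  obtains \<omega> x where "norm \<omega> = 1" "x \<in> cball 0 1" "1 - \<epsilon> \<le> norm (x' x)"
    "2 - \<epsilon> \<le> norm (smul \<omega> (\<Phi> x) + y)"
proof -
  define e where "e = \<epsilon> / 2"
  have e: "e > 0" using \<epsilon> by (simp add: e_def)
  have "sup_norm \<Phi> + sup_norm (tensor smul x' y) = 2"
    by (simp add: \<Phi> tensor_ell_infty(2)[OF x'(1)] x' y)
  with max[unfolded is_maximum_iff[OF \<Phi>(1) tensor_ell_infty(1)[OF x'(1)]]] e
  obtain \<omega> x where \<omega>: "norm \<omega> = 1" and x: "x \<in> cball 0 1"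
    "2 - e \<le> norm (\<Phi> x + smul \<omega> (smul (x' x) y))"
    unfolding tensor_def by metis
  let ?a = "x' x"
  have a: "norm ?a \<le> 1" using norm_le_sup_norm[OF x'(1), of x] x'(2) by simp
  have "norm (\<Phi> x + smul \<omega> (smul ?a y)) \<le> norm (\<Phi> x) + norm ?a"
    using norm_triangle_ineq[of "\<Phi> x" "smul \<omega> (smul ?a y)"] by (simp add: norm_smul norm_mult \<omega> y)
  then have a_ge: "1 - e \<le> norm ?a" using x(2) norm_le_sup_norm[OF \<Phi>(1), of x] \<Phi>(2) by linarith
  obtain \<theta> where \<theta>: "norm \<theta> = 1" "\<theta> * ?a = of_real (norm ?a)"
    using unimodular_rotation by blast
  let ?u = "smul (\<theta> / \<omega>) (\<Phi> x)"
  have "smul (\<theta> / \<omega>) (\<Phi> x + smul \<omega> (smul ?a y)) = ?u + smul (\<theta> * ?a) y"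
    using \<omega> by (auto simp: scale_right_distrib)
  also have "smul (\<theta> * ?a) y = norm ?a *\<^sub>R y" by (simp only: \<theta>(2) smul_of_real)
  finally have "norm (smul (\<theta> / \<omega>) (\<Phi> x + smul \<omega> (smul ?a y))) = norm (?u + norm ?a *\<^sub>R y)"
    by (rule arg_cong)
  then have "2 - e \<le> norm (?u + norm ?a *\<^sub>R y)"
    using x(2) \<omega> \<theta>(1) by (simp add: norm_smul norm_divide)
  also have "?u + norm ?a *\<^sub>R y = (?u + y) - (1 - norm ?a) *\<^sub>R y" by (simp add: scaleR_diff_left)
  also have "norm \<dots> \<le> norm (?u + y) + norm ((1 - norm ?a) *\<^sub>R y)" by (rule norm_triangle_ineq4)
  also have "norm ((1 - norm ?a) *\<^sub>R y) = 1 - norm ?a" using a y by simp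
  finally have "2 - \<epsilon> \<le> norm (?u + y)" using a_ge by (simp add: e_def)
  moreover have "1 - \<epsilon> \<le> norm ?a" using a_ge \<epsilon> by (simp add: e_def)
  moreover have "norm (\<theta> / \<omega>) = 1" by (simp add: norm_divide \<theta> \<omega>)
  ultimately show ?thesis using x(1) that by blast
qed

end

theorem theorem4p13:
  fixes scaleX :: "'k::real_or_complex \<Rightarrow> 'x::banach \<Rightarrow> 'x"
    and scaleY :: "'k \<Rightarrow> 'y::banach \<Rightarrow> 'y"
    and Z :: "('x \<Rightarrow> 'k) set"
    and \<Phi> :: "'x \<Rightarrow> 'y"
  assumes "banach_space_over scaleX"
    and "banach_space_over scaleY"
    and "linear_subspace_ell_infty Z"
    and "\<Phi> \<in> ell_infty"
    and "sup_norm \<Phi> = 1"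
  shows
    "let
       P1 = (\<forall>x'\<in>Z. \<forall>y::'y.
               is_maximum {sup_norm (\<Phi> + fun_scale scaleY \<omega> (tensor scaleY x' y)) | \<omega>. norm \<omega> = 1}
                 (sup_norm \<Phi> + sup_norm (tensor scaleY x' y)));
       P2 = (\<forall>x'\<in>Z. \<forall>y::'y. \<forall>\<epsilon>::real. sup_norm x' = 1 \<longrightarrow> norm y = 1 \<longrightarrow> \<epsilon> > 0 \<longrightarrow>
               (\<exists>\<omega>\<^sub>1 \<omega>\<^sub>2. norm \<omega>\<^sub>1 = 1 \<and> norm \<omega>\<^sub>2 = 1 \<and> (\<exists>x\<in>cball 0 1.
                  re (\<omega>\<^sub>1 * x' x) \<ge> 1 - \<epsilon> \<and> norm (scaleY \<omega>\<^sub>2 (\<Phi> x) + y) \<ge> 2 - \<epsilon>)));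
       P3 = (\<forall>x'\<in>Z. \<forall>y::'y. \<forall>\<epsilon>::real. sup_norm x' = 1 \<longrightarrow> norm y = 1 \<longrightarrow> \<epsilon> > 0 \<longrightarrow>
               (\<exists>\<omega>. norm \<omega> = 1 \<and> (\<exists>x\<in>cball 0 1.
                  norm (x' x) \<ge> 1 - \<epsilon> \<and> norm (scaleY \<omega> (\<Phi> x) + y) \<ge> 2 - \<epsilon>)));
       P4 = (\<forall>\<Psi>\<in>ell_infty. weakly_compact_map scaleY \<Psi> \<longrightarrow>
               (\<forall>y'\<in>dual_space scaleY. y' \<circ> \<Psi> \<in> Z) \<longrightarrow>
               is_maximum {sup_norm (\<Phi> + fun_scale scaleY \<omega> \<Psi>) | \<omega>. norm \<omega> = 1}
                 (sup_norm \<Phi> + sup_norm \<Psi>))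
     in (P1 \<longleftrightarrow> P2) \<and> (P2 \<longleftrightarrow> P3) \<and> (P3 \<longleftrightarrow> P4)"
proof -
  interpret Y: banach_space_over scaleY by fact
  note Z = assms(3) and \<Phi> = assms(4,5)
  have Z_ell: "x' \<in> ell_infty" if "x' \<in> Z" for x'
    using Z that by (auto simp: linear_subspace_ell_infty_def)
  define P1 where "P1 = (\<forall>x'\<in>Z. \<forall>y::'y.
    is_maximum {sup_norm (\<Phi> + fun_scale scaleY \<omega> (tensor scaleY x' y)) | \<omega>. norm \<omega> = 1}
      (sup_norm \<Phi> + sup_norm (tensor scaleY x' y)))"
  define P2 where "P2 = (\<forall>x'\<in>Z. \<forall>y::'y. \<forall>\<epsilon>::real. sup_norm x' = 1 \<longrightarrow> norm y = 1 \<longrightarrow> \<epsilon> > 0 \<longrightarrow>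
    (\<exists>\<omega>\<^sub>1 \<omega>\<^sub>2. norm \<omega>\<^sub>1 = 1 \<and> norm \<omega>\<^sub>2 = 1 \<and> (\<exists>x\<in>cball 0 1.
      re (\<omega>\<^sub>1 * x' x) \<ge> 1 - \<epsilon> \<and> norm (scaleY \<omega>\<^sub>2 (\<Phi> x) + y) \<ge> 2 - \<epsilon>)))"
  define P3 where "P3 = (\<forall>x'\<in>Z. \<forall>y::'y. \<forall>\<epsilon>::real. sup_norm x' = 1 \<longrightarrow> norm y = 1 \<longrightarrow> \<epsilon> > 0 \<longrightarrow>
    (\<exists>\<omega>. norm \<omega> = 1 \<and> (\<exists>x\<in>cball 0 1.
      norm (x' x) \<ge> 1 - \<epsilon> \<and> norm (scaleY \<omega> (\<Phi> x) + y) \<ge> 2 - \<epsilon>)))"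
  define P4 where "P4 = (\<forall>\<Psi>\<in>ell_infty. weakly_compact_map scaleY \<Psi> \<longrightarrow>
    (\<forall>y'\<in>dual_space scaleY. y' \<circ> \<Psi> \<in> Z) \<longrightarrow>
    is_maximum {sup_norm (\<Phi> + fun_scale scaleY \<omega> \<Psi>) | \<omega>. norm \<omega> = 1}
      (sup_norm \<Phi> + sup_norm \<Psi>))"
  \<comment> \<open>The largest real part among the rotations of a scalar is its modulus, and (2)
    and (3) differ only in this.\<close>
  have rotate: "(\<exists>\<omega>. norm \<omega> = 1 \<and> r \<le> re (\<omega> * a)) \<longleftrightarrow> r \<le> norm a" for r and a :: 'k
  proof
    assume "\<exists>\<omega>. norm \<omega> = 1 \<and> r \<le> re (\<omega> * a)"
    then obtain \<omega> where "norm \<omega> = 1" "r \<le> re (\<omega> * a)" by blast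
    then show "r \<le> norm a" using re_le_norm[of "\<omega> * a"] by (simp add: norm_mult)
  next
    assume r: "r \<le> norm a"
    obtain \<omega> where "norm \<omega> = 1" "\<omega> * a = of_real (norm a)" using unimodular_rotation by blast
    with r show "\<exists>\<omega>. norm \<omega> = 1 \<and> r \<le> re (\<omega> * a)" by (intro exI[of _ \<omega>]) simp
  qed
  have 23: "P2 \<longleftrightarrow> P3"
    unfolding P2_def P3_def rotate[symmetric] by blast
  have 34: P4 if P3
    unfolding P4_def
  proof (intro ballI impI)
    fix \<Psi> :: "'x \<Rightarrow> 'y"
    assume \<Psi>: "\<Psi> \<in> ell_infty" "weakly_compact_map scaleY \<Psi>"
      and \<Psi>Z: "\<forall>y'\<in>dual_space scaleY. y' \<circ> \<Psi> \<in> Z"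
    show "is_maximum {sup_norm (\<Phi> + fun_scale scaleY \<omega> \<Psi>) | \<omega>. norm \<omega> = 1}
      (sup_norm \<Phi> + sup_norm \<Psi>)"
      using Z \<Phi> _ \<Psi> bspec[OF \<Psi>Z]
    proof (rule Y.weakly_compact_alternative_Daugavet)
      show "\<exists>\<omega>. norm \<omega> = 1 \<and> (\<exists>x\<in>cball 0 1. norm (x' x) \<ge> 1 - \<epsilon> \<and> norm (scaleY \<omega> (\<Phi> x) + y) \<ge> 2 - \<epsilon>)"
        if "x' \<in> Z" "sup_norm x' = 1" "norm y = 1" "\<epsilon> > 0" for x' y \<epsilon>
        using \<open>P3\<close> that unfolding P3_def by blast
    qed
  qed
  have 41: P1 if P4
    unfolding P1_def
  proof (intro ballI allI)
    fix x' y assume x': "x' \<in> Z"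
    have "\<forall>F\<in>dual_space scaleY. F \<circ> tensor scaleY x' y \<in> Z"
      by (simp add: Y.dual_comp_tensor subspace_ell_infty_scale[OF Z x'])
    with that Y.tensor_ell_infty(1)[OF Z_ell[OF x']] Y.weakly_compact_tensor[OF Z_ell[OF x']]
    show "is_maximum {sup_norm (\<Phi> + fun_scale scaleY \<omega> (tensor scaleY x' y)) | \<omega>. norm \<omega> = 1}
      (sup_norm \<Phi> + sup_norm (tensor scaleY x' y))"
      unfolding P4_def by blast
  qed
  have 13: P3 if P1
    unfolding P3_def
  proof (intro ballI allI impI)
    fix x' and y :: 'y and \<epsilon> :: real
    assume x': "x' \<in> Z" "sup_norm x' = 1" and y: "norm y = 1" and \<epsilon>: "\<epsilon> > 0"
    have "is_maximum {sup_norm (\<Phi> + fun_scale scaleY \<omega> (tensor scaleY x' y)) | \<omega>. norm \<omega> = 1}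
      (sup_norm \<Phi> + sup_norm (tensor scaleY x' y))"
      using \<open>P1\<close> x'(1) unfolding P1_def by blast
    with \<Phi> Z_ell[OF x'(1)] x'(2) y \<epsilon>
    obtain \<omega> x where "norm \<omega> = 1" "x \<in> cball 0 1" "1 - \<epsilon> \<le> norm (x' x)"
      "2 - \<epsilon> \<le> norm (scaleY \<omega> (\<Phi> x) + y)"
      by (rule Y.rank_one_imp_approximate)
    then show "\<exists>\<omega>. norm \<omega> = 1 \<and> (\<exists>x\<in>cball 0 1.
      norm (x' x) \<ge> 1 - \<epsilon> \<and> norm (scaleY \<omega> (\<Phi> x) + y) \<ge> 2 - \<epsilon>)"
      by blast
  qed
  \<comment> \<open>The cycle from (3) to (4) to (1) and back to (3), with (2) attached to
    (3).\<close>
  have "(P1 \<longleftrightarrow> P2) \<and> (P2 \<longleftrightarrow> P3) \<and> (P3 \<longleftrightarrow> P4)"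
    using 23 34 41 13 by blast
  then show ?thesis
    unfolding P1_def P2_def P3_def P4_def Let_def .
qed

end
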